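(* Let $T>0$ and let $\omega$ be any nonempty open subset of $(0,2\pi)$. For every $(u_0,v_0)\in (H^2_{per}(0,2\pi))^*\times (H^1_{per}(0,2\pi))^*$ with $\langle v_0,1\rangle_{(H^1_{per})^*,H^1_{per}}=0$, there exists a control $h\in L^2((0,T)\times(0,2\pi))$ of the form $h(t,x)=1_{\omega}(x)f(x)g(t)$ such that the solution $(u,v)$ of \[ \begin{cases} u_t+u_{xxxx}+u_{xxx}+u_{xx}-v_x=h, & (t,x)\in(0,T)\times(0,2\pi),\\ v_t-v_{xx}+v_x-u_x=0, & (t,x)\in(0,T)\times(0,2\pi),\\ \partial_x^j u(t,0)=\partial_x^j u(t,2\pi),\ j=0,1,2,3, & t\in(0,T),\\ \partial_x^j v(t,0)=\partial_x^j v(t,2\pi),\ j=0,1, & t\in(0,T),\\ u(0,\cdot)=u_0,\ v(0,\cdot)=v_0, \end{cases} \] satisfies $u(T,\cdot)=0$ and $v(T,\cdot)=0$.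
   Context: Functions are complex valued. For $s\ge 0$, $H^s_{per}(0,2\pi)$ is the space of $\phi=\sum_{k\in\mathbb Z}\phi_k e^{-ikx}\in L^2(0,2\pi)$ with $\sum_k(1+|k|^2)^s|\phi_k|^2<\infty$, with the corresponding norm. $(H^s_{per})^*$ denotes its dual with respect to the pivot space $L^2(0,2\pi)$, and $\langle\cdot,\cdot\rangle_{(H^s_{per})^*,H^s_{per}}$ the duality pairing. The system is well posed with solution $(u,v)\in C([0,T];(H^2_{per})^*\times(H^1_{per})^* )$ (defined by transposition/duality). $1_\omega$ is the indicator function of $\omega$. *)

theory Defs
  imports "HOL-Analysis.Analysis"
begin

text \<open>Convention: a periodic function/distribution is represented by its Fourier
coefficients c :: int => complex, phi = sum_k c k * exp(-i k x).\<close>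

definition fcoef :: "(real \<Rightarrow> complex) \<Rightarrow> int \<Rightarrow> complex" where
  "fcoef \<phi> k = (1 / (2 * pi)) * (LINT x:{0..2*pi}|lborel. \<phi> x * exp (\<i> * of_int k * of_real x))"

text \<open>The dual space (H^s_per)^* (s >= 0) as coefficient sequences with
  sum_k (1+k^2)^(-s) |c_k|^2 < infinity, and its norm.\<close>
definition dual_space :: "real \<Rightarrow> (int \<Rightarrow> complex) \<Rightarrow> bool" where
  "dual_space s c \<longleftrightarrow>
     (\<lambda>k. (cmod (c k))\<^sup>2 / (1 + (real_of_int k)\<^sup>2) powr s) summable_on UNIV"

definition dual_norm :: "real \<Rightarrow> (int \<Rightarrow> complex) \<Rightarrow> real" where
  "dual_norm s c = sqrt (\<Sum>\<^sub>\<infinity>k. (cmod (c k))\<^sup>2 / (1 + (real_of_int k)\<^sup>2) powr s)"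

text \<open>Duality pairing (H^s)^* x H^s extending the L2(0,2pi) inner product:
  <c, phi> = 2pi sum_k c_k conj(phi_k), phi given by its Fourier coefficients.\<close>
definition dual_pair :: "(int \<Rightarrow> complex) \<Rightarrow> (int \<Rightarrow> complex) \<Rightarrow> complex" where
  "dual_pair c \<phi> = 2 * pi * (\<Sum>\<^sub>\<infinity>k. c k * cnj (\<phi> k))"

definition one_coef :: "int \<Rightarrow> complex" where
  "one_coef k = (if k = 0 then 1 else 0)"

definition cont_dual :: "real \<Rightarrow> real \<Rightarrow> (real \<Rightarrow> int \<Rightarrow> complex) \<Rightarrow> bool" where
  "cont_dual s T w \<longleftrightarrow> (\<forall>t\<in>{0..T}. dual_space s (w t)) \<and>
     (\<forall>t\<in>{0..T}. \<forall>\<epsilon>>0. \<exists>\<delta>>0. \<forall>t'\<in>{0..T}.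
        \<bar>t' - t\<bar> < \<delta> \<longrightarrow> dual_norm s (\<lambda>k. w t' k - w t k) < \<epsilon>)"

text \<open>The solution (u,v) in C([0,T];(H^2_per)^* x (H^1_per)^*) of the coupled system
  u_t + u_xxxx + u_xxx + u_xx - v_x = h, v_t - v_xx + v_x - u_x = 0, periodic b.c.,
  u(0)=u0, v(0)=v0, written on Fourier modes (d/dx acts as -ik) in integral (mild) form:
  u_k' = -(k^4 + i k^3 - k^2) u_k - i k v_k + h_k,  v_k' = -(k^2 - i k) v_k - i k u_k.\<close>
definition is_solution ::
  "real \<Rightarrow> (real \<Rightarrow> real \<Rightarrow> complex) \<Rightarrow> (int \<Rightarrow> complex) \<Rightarrow> (int \<Rightarrow> complex)
     \<Rightarrow> (real \<Rightarrow> int \<Rightarrow> complex) \<Rightarrow> (real \<Rightarrow> int \<Rightarrow> complex) \<Rightarrow> bool" where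
  "is_solution T h u0 v0 u v \<longleftrightarrow>
     cont_dual 2 T u \<and> cont_dual 1 T v \<and>
     (\<forall>k::int. \<forall>t\<in>{0..T}.
        u t k = u0 k + (LINT s:{0..t}|lborel.
           - (of_int k ^ 4 + \<i> * of_int k ^ 3 - of_int k ^ 2) * u s k
           - \<i> * of_int k * v s k + fcoef (h s) k)
      \<and> v t k = v0 k + (LINT s:{0..t}|lborel.
           - (of_int k ^ 2 - \<i> * of_int k) * v s k - \<i> * of_int k * u s k))"

definition L2_rect :: "real \<Rightarrow> (real \<Rightarrow> real \<Rightarrow> complex) \<Rightarrow> bool" where
  "L2_rect T h \<longleftrightarrow> (\<lambda>p. h (fst p) (snd p)) \<in> borel_measurable lborel \<and>
     set_integrable lborel ({0<..<T} \<times> {0<..<2*pi}) (\<lambda>p. (cmod (h (fst p) (snd p)))\<^sup>2)"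

end

theory Submission
  imports Defs
begin

text \<open>
  With \<open>f(x) = e\<^sup>x\<close> on a compact interval inside \<open>\<omega>\<close>, every Fourier coefficient \<open>F\<^sub>k\<close> of the profile
  satisfies \<open>|F\<^sub>k| \<ge> c / (1 + |k|)\<close>. Diagonalising the \<open>2 \<times> 2\<close> system of the \<open>k\<close>-th mode turns null
  controllability into a moment problem: \<open>\<integral> e\<^sup>\<mu>\<^sup>t g(t) dt\<close> is prescribed for all eigenvalues \<open>\<mu>\<close>.

  The moment problem is solved by delays. The operator \<open>\<psi>(t) \<mapsto> \<psi>(t) - e\<^bsup>-\<mu>\<delta>\<^esup> \<psi>(t - \<delta>)\<close> annihilates the
  moment at \<open>\<mu>\<close> and has norm at most \<open>1 + e\<^bsup>-\<delta> Re \<mu>\<^esup>\<close>, so the composition over all eigenvalues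
  \<open>\<mu>\<^sub>n\<close>, \<open>n \<noteq> m\<close>, converges as soon as \<open>\<Sum> e\<^bsup>-\<delta>\<^sub>n Re \<mu>\<^sub>n\<^esup> < \<infinity>\<close>, and it enlarges supports by
  \<open>\<Sum> \<delta>\<^sub>n\<close> only. Since \<open>Re \<mu>\<^sub>n\<close> grows at least quadratically in the frequency, both sums can be made
  finite with \<open>\<Sum> \<delta>\<^sub>n\<close> arbitrarily small. Applied to \<open>e\<^bsup>-\<mu>\<^sub>m t\<^esup>\<close> times a bump, it yields a biorthogonal
  family; its \<open>m\<close>-th moment is a multiple of \<open>\<Prod> (1 - e\<^bsup>(\<mu>\<^sub>m - \<mu>\<^sub>n) \<delta>\<^sub>n\<^esup>)\<close>, which the separation of the
  spectrum bounds below by \<open>c e\<^bsup>-\<epsilon> Re \<mu>\<^sub>m\<^esup>\<close>.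

  The spectrum is separated because the eigenvalues of mode \<open>k\<close> lie within \<open>2/5\<close> of the Gaussian
  integers \<open>k\<^sup>4 - k\<^sup>2 + \<i> k\<^sup>3\<close> and \<open>k\<^sup>2 - \<i> k\<close>, whose real parts differ except for complex conjugates
  and for \<open>k = 0, \<plusminus>1\<close>.
\<close>

section \<open>The moment problem for a separated spectrum\<close>

definition moment :: "complex \<Rightarrow> (real \<Rightarrow> complex) \<Rightarrow> complex" where
  "moment z \<psi> = (LINT t|lborel. exp (z * of_real t) * \<psi> t)"

definition cont_supp :: "real \<Rightarrow> (real \<Rightarrow> complex) \<Rightarrow> bool" where
  "cont_supp T \<psi> \<longleftrightarrow> continuous_on UNIV \<psi> \<and> (\<forall>t. t \<notin> {0..T} \<longrightarrow> \<psi> t = 0)"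

lemma cont_supp_mono: "cont_supp S \<psi> \<Longrightarrow> S \<le> T \<Longrightarrow> cont_supp T \<psi>"
  by (auto simp: cont_supp_def)

lemma cont_supp_integrable:
  assumes "cont_supp T \<psi>"
  shows "integrable lborel (\<lambda>t. exp (z * of_real t) * \<psi> t)"
proof -
  have "continuous_on {0..T} \<psi>"
    using assms continuous_on_subset unfolding cont_supp_def by blast
  then have "set_integrable lborel {0..T} (\<lambda>t. exp (z * of_real t) * \<psi> t)"
    by (intro borel_integrable_atLeastAtMost' continuous_intros)
  moreover have "(\<lambda>t. indicator {0..T} t *\<^sub>R (exp (z * of_real t) * \<psi> t)) = (\<lambda>t. exp (z * of_real t) * \<psi> t)"
    using assms by (auto simp: cont_supp_def indicator_def fun_eq_iff)
  ultimately show ?thesis by (simp add: set_integrable_def)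
qed

lemma moment_shift: "moment z (\<lambda>t. \<psi> (t - d)) = exp (z * of_real d) * moment z \<psi>"
proof -
  have "moment z (\<lambda>t. \<psi> (t - d)) = (LINT t|lborel. exp (z * of_real (d + 1 * t)) * \<psi> (d + 1 * t - d))"
    unfolding moment_def by (subst lborel_integral_real_affine[where c = 1 and t = d]) auto
  also have "\<dots> = (LINT t|lborel. exp (z * of_real d) * (exp (z * of_real t) * \<psi> t))"
    by (rule Bochner_Integration.integral_cong) (auto simp: distrib_left exp_add)
  finally show ?thesis by (simp add: moment_def)
qed

lemma moment_cmult: "moment z (\<lambda>t. c * \<psi> t) = c * moment z \<psi>"
proof -
  have "moment z (\<lambda>t. c * \<psi> t) = (LINT t|lborel. c * (exp (z * of_real t) * \<psi> t))"
    unfolding moment_def by (rule Bochner_Integration.integral_cong) auto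
  then show ?thesis by (simp add: moment_def)
qed

lemma moment_diff:
  assumes "cont_supp T \<phi>" "cont_supp T \<psi>"
  shows "moment z (\<lambda>t. \<phi> t - \<psi> t) = moment z \<phi> - moment z \<psi>"
  unfolding moment_def
  using Bochner_Integration.integral_diff[OF cont_supp_integrable[OF assms(1), of z] cont_supp_integrable[OF assms(2), of z]]
  by (simp add: right_diff_distrib)

text \<open>The Weierstrass M-test gives a continuous limit. The common support keeps the
  exponential bounded, so one integrable function dominates all partial sums and the moment can be
  taken term by term.\<close>

lemma moment_suminf:
  fixes \<phi> :: "nat \<Rightarrow> real \<Rightarrow> complex"
  assumes supp: "\<And>n. cont_supp T (\<phi> n)" and bd: "\<And>n t. cmod (\<phi> n t) \<le> b n" and b: "summable b"
  shows "cont_supp T (\<lambda>t. \<Sum>n. \<phi> n t)"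
    and "\<And>t. cmod (\<Sum>n. \<phi> n t) \<le> suminf b"
    and "\<And>z. (\<lambda>n. moment z (\<phi> n)) sums moment z (\<lambda>t. \<Sum>n. \<phi> n t)"
proof -
  have unif: "uniform_limit UNIV (\<lambda>n t. \<Sum>i<n. \<phi> i t) (\<lambda>t. \<Sum>n. \<phi> n t) sequentially"
    by (rule Weierstrass_m_test) (use bd b in auto)
  have cont: "continuous_on UNIV (\<lambda>t. \<Sum>n. \<phi> n t)"
  proof (rule uniform_limit_theorem[OF _ unif])
    show "\<forall>\<^sub>F n in sequentially. continuous_on UNIV (\<lambda>t. \<Sum>i<n. \<phi> i t)"
      using supp by (auto simp: cont_supp_def intro!: always_eventually continuous_on_sum)
  qed auto
  show cs: "cont_supp T (\<lambda>t. \<Sum>n. \<phi> n t)"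
    using supp cont by (auto simp: cont_supp_def)
  have sn: "summable (\<lambda>n. norm (\<phi> n t))" for t
    by (rule summable_comparison_test[OF _ b]) (use bd in auto)
  show "cmod (\<Sum>n. \<phi> n t) \<le> suminf b" for t
    using summable_norm[OF sn, of t] suminf_le[OF bd sn b, of t] by linarith
  show "(\<lambda>n. moment z (\<phi> n)) sums moment z (\<lambda>t. \<Sum>n. \<phi> n t)" for z
    unfolding moment_def sums_def
  proof -
    let ?e = "\<lambda>t. indicator {0..T} t * (exp (\<bar>Re z\<bar> * T) * suminf b) :: real"
    have eq: "(\<Sum>i<n. LINT t|lborel. exp (z * of_real t) * \<phi> i t) = (LINT t|lborel. exp (z * of_real t) * (\<Sum>i<n. \<phi> i t))" for n
      unfolding sum_distrib_left by (rule Bochner_Integration.integral_sum[symmetric]) (rule cont_supp_integrable[OF supp])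
    have meas: "\<phi> n \<in> borel_measurable borel" for n
      using supp[of n] by (auto simp: cont_supp_def intro: borel_measurable_continuous_onI)
    show "(\<lambda>n. \<Sum>i<n. LINT t|lborel. exp (z * of_real t) * \<phi> i t) \<longlonglongrightarrow> (LINT t|lborel. exp (z * of_real t) * (\<Sum>n. \<phi> n t))"
      unfolding eq
    proof (rule integral_dominated_convergence[where w = ?e])
      show "(\<lambda>t. exp (z * of_real t) * (\<Sum>n. \<phi> n t)) \<in> borel_measurable lborel"
        using borel_measurable_integrable[OF cont_supp_integrable[OF cs]] .
      show "(\<lambda>t. exp (z * of_real t) * (\<Sum>i<n. \<phi> i t)) \<in> borel_measurable lborel" for n
        using meas by measurable
      show "integrable lborel ?e"
        using borel_integrable_atLeastAtMost'[of 0 T "\<lambda>_. exp (\<bar>Re z\<bar> * T) * suminf b"] by (simp add: set_integrable_def)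
      show "AE t in lborel. (\<lambda>i. exp (z * of_real t) * (\<Sum>i<i. \<phi> i t)) \<longlonglongrightarrow> exp (z * of_real t) * (\<Sum>n. \<phi> n t)"
        by (intro always_eventually allI tendsto_mult_left summable_LIMSEQ summable_norm_cancel[OF sn])
      show "AE t in lborel. norm (exp (z * of_real t) * (\<Sum>i<n. \<phi> i t)) \<le> ?e t" for n
      proof (intro always_eventually allI)
        fix t
        show "norm (exp (z * of_real t) * (\<Sum>i<n. \<phi> i t)) \<le> ?e t"
        proof (cases "t \<in> {0..T}")
          case False
          then have "\<phi> i t = 0" for i using supp[of i] by (auto simp: cont_supp_def)
          then show ?thesis using False by simp
        next
          case True
          have "norm (exp (z * of_real t)) \<le> exp (\<bar>Re z\<bar> * T)"
            using True mult_mono[of "Re z" "\<bar>Re z\<bar>" t T] by (simp add: norm_exp_eq_Re mult.commute)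
          moreover have "norm (\<Sum>i<n. \<phi> i t) \<le> suminf b"
          proof -
            have b0: "0 \<le> b i" for i using bd[of i 0] norm_ge_zero[of "\<phi> i 0"] by linarith
            have "norm (\<Sum>i<n. \<phi> i t) \<le> (\<Sum>i<n. b i)" by (rule sum_norm_le) (rule bd)
            also have "\<dots> \<le> suminf b" by (rule sum_le_suminf[OF b]) (auto simp: b0)
            finally show ?thesis .
          qed
          ultimately have "norm (exp (z * of_real t)) * norm (\<Sum>i<n. \<phi> i t) \<le> exp (\<bar>Re z\<bar> * T) * suminf b"
            by (intro mult_mono) auto
          then show ?thesis using True by (simp add: norm_mult)
        qed
      qed
    qed
  qed
qed

text \<open>The composition of the delay operators of the first indices. Index \<open>m\<close> is
  skipped so that the moment at \<open>\<mu> m\<close> survives while those at the other eigenvalues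
  are annihilated one by one.\<close>

primrec delay_filter :: "(nat \<Rightarrow> complex) \<Rightarrow> (nat \<Rightarrow> real) \<Rightarrow> nat \<Rightarrow> (real \<Rightarrow> complex) \<Rightarrow> nat \<Rightarrow> real \<Rightarrow> complex" where
  "delay_filter \<mu> \<delta> m \<psi> 0 = \<psi>"
| "delay_filter \<mu> \<delta> m \<psi> (Suc n) = (if n = m then delay_filter \<mu> \<delta> m \<psi> n
     else (\<lambda>t. delay_filter \<mu> \<delta> m \<psi> n t - exp (- \<mu> n * of_real (\<delta> n)) * delay_filter \<mu> \<delta> m \<psi> n (t - \<delta> n)))"

text \<open>\<open>L\<close> measures how small the factors \<open>1 - e\<^bsup>(\<mu>\<^sub>m - \<mu>\<^sub>n) \<delta>\<^sub>n\<^esup>\<close> may become; they matter only for the indices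
  with \<open>Re \<mu>\<^sub>n < 2 Re \<mu>\<^sub>m\<close>, where the last assumption makes their total cost \<open>o(Re \<mu>\<^sub>m)\<close>.\<close>

locale separated_spectrum =
  fixes \<mu> :: "nat \<Rightarrow> complex" and \<delta> L :: "nat \<Rightarrow> real" and T :: real
  assumes T_pos: "0 < T"
    and Re_nonneg: "0 \<le> Re (\<mu> n)"
    and delay_pos: "0 < \<delta> n"
    and delay_summable: "summable \<delta>"
    and delay_total: "suminf \<delta> \<le> T / 2"
    and damping: "summable (\<lambda>n. exp (- (Re (\<mu> n) * \<delta> n / 2)))"
    and gap: "n \<noteq> m \<Longrightarrow> exp (- L n) \<le> cmod (1 - exp ((\<mu> m - \<mu> n) * of_real (\<delta> n)))"
    and L_nonneg: "0 \<le> L n"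
    and L_summable: "summable (\<lambda>n. L n / (1 + Re (\<mu> n)))"
begin

text \<open>A fixed finite head costs a constant. Beyond it, a factor with
  \<open>2 * Re (\<mu> m) \<le> Re (\<mu> n)\<close> differs from 1 by a summable term at most; any
  other factor costs \<open>L n\<close>, which is at most \<open>1 + 2 * Re (\<mu> m)\<close> times
  a term of a convergent series. Only this last kind grows with \<open>m\<close>, and a head taken
  long enough makes its rate at most \<epsilon>.\<close>

lemma gap_product:
  assumes "0 < \<epsilon>"
  shows "\<exists>c>0. \<forall>m N. c * exp (- \<epsilon> * Re (\<mu> m)) \<le> cmod (\<Prod>n\<in>{..<N}-{m}. 1 - exp ((\<mu> m - \<mu> n) * of_real (\<delta> n)))"
proof -
  define r where "r = (\<lambda>n. exp (- (Re (\<mu> n) * \<delta> n / 2)))"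
  define q where "q = (\<lambda>n. L n / (1 + Re (\<mu> n)))"
  have r: "summable r" and q: "summable q" unfolding r_def q_def by (fact damping, fact L_summable)
  have r0: "0 \<le> r n" and q0: "0 \<le> q n" for n using L_nonneg[of n] Re_nonneg[of n] by (simp_all add: r_def q_def)
  have "\<forall>\<^sub>F n in sequentially. r n < 1/2"
    using summable_LIMSEQ_zero[OF r] by (rule order_tendstoD) simp
  then obtain N1 where N1: "\<And>n. n \<ge> N1 \<Longrightarrow> r n < 1/2" by (auto simp: eventually_sequentially)
  obtain N2 where N2: "\<And>n. n \<ge> N2 \<Longrightarrow> norm (\<Sum>i. q (i + n)) < \<epsilon>/2"
    using suminf_exist_split[OF _ q, of "\<epsilon>/2"] assms by auto
  \<comment> \<open>Beyond \<open>N1\<close> the bound \<open>exp (- 2 * r n) \<le> 1 - r n\<close>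
    is available; beyond \<open>N2\<close> the tail of \<open>q\<close>, multiplied by
    \<open>1 + 2 * R\<close>, stays below \<open>\<epsilon> / 2 + \<epsilon> * R\<close>.\<close>
  define N0 where "N0 = max N1 N2"
  define C where "C = (\<Sum>n<N0. L n) + 2 * suminf r + \<epsilon>/2"
  have "exp (- C) * exp (- \<epsilon> * Re (\<mu> m)) \<le> cmod (\<Prod>n\<in>{..<N}-{m}. 1 - exp ((\<mu> m - \<mu> n) * of_real (\<delta> n)))" for m N
  proof -
    define R where "R = Re (\<mu> m)"
    have R0: "0 \<le> R" using Re_nonneg by (simp add: R_def)
    define x where "x n = (if n < N0 then L n else 2 * r n + (1 + 2 * R) * q n)" for n
    have fac: "exp (- x n) \<le> cmod (1 - exp ((\<mu> m - \<mu> n) * of_real (\<delta> n)))" if "n \<noteq> m" for n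
    proof (cases "n < N0")
      case True
      then show ?thesis using gap[OF that] by (simp add: x_def)
    next
      case False
      then have rn: "r n < 1/2" using N1[of n] by (simp add: N0_def)
      show ?thesis
      proof (cases "2 * R \<le> Re (\<mu> n)")
        case True
        \<comment> \<open>One half of \<open>Re (\<mu> n)\<close> absorbs \<open>R\<close>; the
          other half is the rate in \<open>damping\<close>.\<close>
        have "(R - Re (\<mu> n)) * \<delta> n \<le> - (Re (\<mu> n) / 2) * \<delta> n"
          using True delay_pos[of n] by (intro mult_right_mono) auto
        then have "cmod (exp ((\<mu> m - \<mu> n) * of_real (\<delta> n))) \<le> r n"
          by (simp add: norm_exp_eq_Re r_def R_def algebra_simps)
        then have "1 - r n \<le> cmod (1 - exp ((\<mu> m - \<mu> n) * of_real (\<delta> n)))"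
          using norm_triangle_ineq2[of 1 "exp ((\<mu> m - \<mu> n) * of_real (\<delta> n))"] by simp
        moreover have "exp (- x n) \<le> 1 - r n"
        proof -
          have "- r n - 2 * (r n)\<^sup>2 \<le> ln (1 - r n)"
            using ln_one_minus_pos_lower_bound[OF r0] rn by simp
          moreover have "2 * (r n)\<^sup>2 \<le> r n"
            using mult_right_mono[of "r n" "1/2" "r n"] rn r0[of n] by (simp add: power2_eq_square)
          ultimately have "- (2 * r n) \<le> ln (1 - r n)" by linarith
          then have "exp (- (2 * r n)) \<le> exp (ln (1 - r n))" by (simp only: exp_le_cancel_iff)
          also have "\<dots> = 1 - r n" using rn by simp
          finally have "exp (- (2 * r n)) \<le> 1 - r n" .
          moreover have "- x n \<le> - (2 * r n)" using False R0 q0[of n] by (simp add: x_def)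
          ultimately show ?thesis by (meson exp_le_cancel_iff order_trans)
        qed
        ultimately show ?thesis by linarith
      next
        case False2: False
        have "L n * (1 + Re (\<mu> n)) \<le> L n * (1 + 2 * R)"
          using False2 L_nonneg[of n] by (intro mult_left_mono) auto
        then have "L n \<le> (1 + 2 * R) * q n"
          using Re_nonneg[of n] by (simp add: q_def field_simps)
        then have "L n \<le> x n" using False r0[of n] by (simp add: x_def)
        then show ?thesis using gap[OF that] by (meson exp_le_cancel_iff neg_le_iff_le order_trans)
      qed
    qed
    have x0: "0 \<le> x n" for n using L_nonneg R0 r0[of n] q0[of n] by (simp add: x_def)
    \<comment> \<open>The range is enlarged to \<open>N + N0\<close> so that it splits at
      \<open>N0\<close> even when \<open>N < N0\<close>.\<close>
    have "(\<Sum>n\<in>{..<N}-{m}. x n) \<le> (\<Sum>n<N + N0. x n)"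
      by (rule sum_mono2) (auto simp: x0)
    also have "\<dots> = (\<Sum>n<N0. x n) + (\<Sum>n<N. x (n + N0))"
      by (simp add: add.commute[of N] sum.nat_group lessThan_atLeast0 sum.shift_bounds_nat_ivl flip: sum.atLeastLessThan_concat[of 0 N0 "N0 + N"])
         (metis add.commute add_0 sum.shift_bounds_nat_ivl)
    also have "(\<Sum>n<N0. x n) = (\<Sum>n<N0. L n)" by (rule sum.cong) (auto simp: x_def)
    also have "(\<Sum>n<N. x (n + N0)) = 2 * (\<Sum>n<N. r (n + N0)) + (1 + 2 * R) * (\<Sum>n<N. q (n + N0))"
      by (simp add: x_def sum.distrib sum_distrib_left)
    also have "\<dots> \<le> 2 * suminf r + (1 + 2 * R) * (\<epsilon>/2)"
    proof (intro add_mono mult_left_mono)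
      have "(\<Sum>n<N. r (n + N0)) \<le> (\<Sum>n. r (n + N0))"
        using r r0 by (intro sum_le_suminf) (auto simp: summable_iff_shift)
      also have "\<dots> \<le> suminf r"
        using suminf_split_initial_segment[OF r, of N0] sum_nonneg[of "{..<N0}" r] r0 by auto
      finally show "(\<Sum>n<N. r (n + N0)) \<le> suminf r" .
    next
      have "(\<Sum>n<N. q (n + N0)) \<le> (\<Sum>n. q (n + N0))"
        using q q0 by (intro sum_le_suminf) (auto simp: summable_iff_shift)
      also have "\<dots> \<le> \<epsilon>/2" using N2[of N0] by (simp add: N0_def)
      finally show "(\<Sum>n<N. q (n + N0)) \<le> \<epsilon>/2" .
    qed (use R0 in auto)
    finally have "(\<Sum>n\<in>{..<N}-{m}. x n) \<le> C + \<epsilon> * R"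
      by (simp add: C_def algebra_simps)
    then have "exp (- C) * exp (- \<epsilon> * R) \<le> exp (- (\<Sum>n\<in>{..<N}-{m}. x n))"
      by (simp flip: exp_add)
    also have "\<dots> = (\<Prod>n\<in>{..<N}-{m}. exp (- x n))"
      by (simp add: exp_sum flip: sum_negf)
    also have "\<dots> \<le> (\<Prod>n\<in>{..<N}-{m}. cmod (1 - exp ((\<mu> m - \<mu> n) * of_real (\<delta> n))))"
      by (rule prod_mono) (auto intro: fac)
    finally show ?thesis by (simp add: prod_norm R_def)
  qed
  then show ?thesis by (intro exI[of _ "exp (- C)"]) auto
qed

section \<open>Support, size and moments of the filtered functions\<close>

lemma exp_delay_le: "cmod (exp (- \<mu> n * of_real (\<delta> n))) \<le> exp (- (Re (\<mu> n) * \<delta> n / 2))"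
  using mult_nonneg_nonneg[OF Re_nonneg[of n] less_imp_le[OF delay_pos[of n]]] by (simp add: norm_exp_eq_Re mult.commute)

lemma sum_delay_le: "(\<Sum>n<N. \<delta> n) \<le> T / 2"
  using sum_le_suminf[OF delay_summable, of "{..<N}"] delay_total delay_pos
  by (meson finite_lessThan less_imp_le order_trans)

lemma delay_filter_cont_supp:
  assumes "cont_supp (T/2) \<psi>"
  shows "cont_supp (T/2 + (\<Sum>n<N. \<delta> n)) (delay_filter \<mu> \<delta> m \<psi> N)"
proof (induction N)
  case (Suc N)
  let ?Q = "delay_filter \<mu> \<delta> m \<psi> N"
  have c: "continuous_on UNIV ?Q" and s: "\<And>t. t \<notin> {0..T/2 + (\<Sum>n<N. \<delta> n)} \<Longrightarrow> ?Q t = 0"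
    using Suc by (auto simp: cont_supp_def)
  have "continuous_on UNIV (\<lambda>t. ?Q (t - \<delta> N))"
    by (rule continuous_on_compose2[OF c]) (auto intro!: continuous_intros)
  then have "continuous_on UNIV (delay_filter \<mu> \<delta> m \<psi> (Suc N))"
    using c by (auto intro!: continuous_intros)
  moreover have "delay_filter \<mu> \<delta> m \<psi> (Suc N) t = 0" if "t \<notin> {0..T/2 + (\<Sum>n<Suc N. \<delta> n)}" for t
    using s[of t] s[of "t - \<delta> N"] that delay_pos[of N] by auto
  ultimately show ?case by (auto simp: cont_supp_def)
qed (use assms in simp)

lemma delay_filter_cont_supp_T:
  assumes "cont_supp (T/2) \<psi>"
  shows "cont_supp T (delay_filter \<mu> \<delta> m \<psi> N)"
  by (rule cont_supp_mono[OF delay_filter_cont_supp[OF assms]]) (use sum_delay_le[of N] in simp)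

text \<open>Each operator has norm at most \<open>1 + r \<le> exp r\<close>, which turns the product
  of the norms into the exponential of a partial sum of the \<open>damping\<close> series.\<close>

lemma delay_filter_norm:
  assumes "\<And>t. cmod (\<psi> t) \<le> B"
  shows "cmod (delay_filter \<mu> \<delta> m \<psi> N t) \<le> B * exp (\<Sum>n<N. exp (- (Re (\<mu> n) * \<delta> n / 2)))"
proof (induction N arbitrary: t)
  case (Suc N)
  let ?r = "\<lambda>n. exp (- (Re (\<mu> n) * \<delta> n / 2))" and ?Q = "delay_filter \<mu> \<delta> m \<psi> N"
  let ?E = "B * exp (\<Sum>n<N. ?r n)"
  have E0: "0 \<le> ?E" using Suc[of t] norm_ge_zero order_trans by blast
  have le: "?E * (1 + ?r N) \<le> B * exp (\<Sum>n<Suc N. ?r n)"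
    using mult_left_mono[OF exp_ge_add_one_self[of "?r N"] E0] by (simp add: exp_add mult.assoc)
  have "cmod (delay_filter \<mu> \<delta> m \<psi> (Suc N) t) \<le> ?E * (1 + ?r N)"
  proof (cases "N = m")
    case True
    have "?E * 1 \<le> ?E * (1 + ?r N)" by (intro mult_left_mono E0) simp
    then show ?thesis using True Suc[of t] by simp
  next
    case False
    have "cmod (exp (- \<mu> N * of_real (\<delta> N)) * ?Q (t - \<delta> N)) \<le> ?r N * ?E"
      unfolding norm_mult by (intro mult_mono exp_delay_le Suc) auto
    then show ?thesis
      using False Suc[of t] norm_triangle_ineq4[of "?Q t" "exp (- \<mu> N * of_real (\<delta> N)) * ?Q (t - \<delta> N)"]
      by (simp add: algebra_simps)
  qed
  then show ?case using le by linarith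
qed (use assms in simp)

text \<open>By \<open>moment_shift\<close> a delay multiplies a moment by an exponential, so each
  operator acts on the moment at \<open>z\<close> as a scalar, and this scalar vanishes at its own
  eigenvalue.\<close>

lemma moment_delay_filter:
  assumes "cont_supp (T/2) \<psi>"
  shows "moment z (delay_filter \<mu> \<delta> m \<psi> N) = (\<Prod>n\<in>{..<N}-{m}. 1 - exp ((z - \<mu> n) * of_real (\<delta> n))) * moment z \<psi>"
proof (induction N)
  case (Suc N)
  let ?Q = "delay_filter \<mu> \<delta> m \<psi> N" and ?c = "exp (- \<mu> N * of_real (\<delta> N))"
  show ?case
  proof (cases "N = m")
    case True
    then have "{..<Suc N} - {m} = {..<N} - {m}" by auto
    then show ?thesis using True Suc by simp
  next
    case False
    then have "{..<Suc N} - {m} = insert N ({..<N} - {m})" by auto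
    then have prod: "(\<Prod>n\<in>{..<Suc N}-{m}. 1 - exp ((z - \<mu> n) * of_real (\<delta> n)))
      = (1 - exp ((z - \<mu> N) * of_real (\<delta> N))) * (\<Prod>n\<in>{..<N}-{m}. 1 - exp ((z - \<mu> n) * of_real (\<delta> n)))"
      by simp
    have Q: "cont_supp (T/2 + (\<Sum>n<N. \<delta> n)) ?Q" by (rule delay_filter_cont_supp[OF assms])
    have "continuous_on UNIV ?Q" using Q by (simp add: cont_supp_def)
    then have "continuous_on UNIV (\<lambda>t. ?Q (t - \<delta> N))"
      by (rule continuous_on_compose2) (auto intro!: continuous_intros)
    then have sh: "cont_supp (T/2 + (\<Sum>n<Suc N. \<delta> n)) (\<lambda>t. ?c * ?Q (t - \<delta> N))"
      using Q delay_pos[of N] by (auto simp: cont_supp_def intro!: continuous_intros)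
    have "moment z (delay_filter \<mu> \<delta> m \<psi> (Suc N)) = moment z ?Q - moment z (\<lambda>t. ?c * ?Q (t - \<delta> N))"
      using False moment_diff[OF cont_supp_mono[OF Q] sh, of z] delay_pos[of N] by simp
    also have "\<dots> = moment z ?Q - ?c * (exp (z * of_real (\<delta> N)) * moment z ?Q)"
      by (simp only: moment_cmult moment_shift)
    also have "\<dots> = (1 - exp ((z - \<mu> N) * of_real (\<delta> N))) * moment z ?Q"
      by (simp add: algebra_simps exp_add exp_diff exp_minus divide_inverse)
    finally show ?thesis unfolding prod Suc by simp
  qed
qed simp

text \<open>Passage to the limit in the number of operators. The surviving moment is left as a limit
  of finite products because \<open>gap_product\<close> bounds these uniformly in
  \<open>N\<close>.\<close>

lemma biorthogonal_function:
  assumes \<psi>: "cont_supp (T/2) \<psi>" and B: "\<And>t. cmod (\<psi> t) \<le> B"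
  shows "\<exists>Q. cont_supp T Q \<and> (\<forall>t. cmod (Q t) \<le> B * (exp (\<Sum>n. exp (- (Re (\<mu> n) * \<delta> n / 2))))) \<and>
     (\<forall>n. n \<noteq> m \<longrightarrow> moment (\<mu> n) Q = 0) \<and>
     (\<lambda>N. (\<Prod>n\<in>{..<N}-{m}. 1 - exp ((\<mu> m - \<mu> n) * of_real (\<delta> n))) * moment (\<mu> m) \<psi>) \<longlonglongrightarrow> moment (\<mu> m) Q"
proof -
  let ?r = "\<lambda>n. exp (- (Re (\<mu> n) * \<delta> n / 2))" and ?D = "delay_filter \<mu> \<delta> m \<psi>"
  define P where "P = B * exp (suminf ?r)"
  have B0: "0 \<le> B" using B[of 0] norm_ge_zero order_trans by blast
  have DP: "cmod (?D N t) \<le> P" for N t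
  proof -
    have "cmod (?D N t) \<le> B * exp (\<Sum>n<N. ?r n)" by (rule delay_filter_norm[OF B])
    also have "\<dots> \<le> P" unfolding P_def
      by (intro mult_left_mono B0) (simp, intro sum_le_suminf[OF damping], auto)
    finally show ?thesis .
  qed
  then have P0: "0 \<le> P" using norm_ge_zero order_trans by blast
  \<comment> \<open>The increments have the summable bound \<open>?r N * P\<close>, so the limit is
    \<psi> plus their sum and \<open>moment_suminf\<close> applies.\<close>
  define \<phi> where "\<phi> = (\<lambda>N t. ?D (Suc N) t - ?D N t)"
  have \<phi>supp: "cont_supp T (\<phi> N)" for N
    using delay_filter_cont_supp_T[OF \<psi>, of m N] delay_filter_cont_supp_T[OF \<psi>, of m "Suc N"]
    unfolding cont_supp_def \<phi>_def by (auto intro!: continuous_on_diff simp del: delay_filter.simps)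
  have \<phi>bd: "cmod (\<phi> N t) \<le> ?r N * P" for N t
  proof (cases "N = m")
    case True
    then show ?thesis using P0 by (simp add: \<phi>_def)
  next
    case False
    then have "cmod (\<phi> N t) = cmod (exp (- \<mu> N * of_real (\<delta> N))) * cmod (?D N (t - \<delta> N))"
      by (simp add: \<phi>_def norm_mult)
    also have "\<dots> \<le> ?r N * P" by (intro mult_mono exp_delay_le DP) auto
    finally show ?thesis .
  qed
  have sm: "summable (\<lambda>N. ?r N * P)" by (rule summable_mult2[OF damping])
  define S where "S = (\<lambda>t. \<Sum>N. \<phi> N t)"
  note S = moment_suminf[OF \<phi>supp \<phi>bd sm, folded S_def]
  define Q where "Q = (\<lambda>t. \<psi> t + S t)"
  have \<psi>T: "cont_supp T \<psi>" by (rule cont_supp_mono[OF \<psi>]) (use T_pos in simp)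
  have Qsupp: "cont_supp T Q"
    using \<psi>T S(1) by (auto simp: cont_supp_def Q_def intro!: continuous_intros)
  have lim: "(\<lambda>N. ?D N t) \<longlonglongrightarrow> Q t" for t
  proof -
    have "summable (\<lambda>N. \<phi> N t)"
      by (rule summable_comparison_test[OF _ sm]) (use \<phi>bd in auto)
    then have "(\<lambda>N. \<psi> t + (\<Sum>i<N. \<phi> i t)) \<longlonglongrightarrow> Q t"
      unfolding Q_def S_def by (intro tendsto_add tendsto_const summable_LIMSEQ)
    moreover have "\<psi> t + (\<Sum>i<N. \<phi> i t) = ?D N t" for N
      unfolding \<phi>_def sum_lessThan_telescope[of "\<lambda>n. ?D n t"] by simp
    ultimately show ?thesis by simp
  qed
  have Qbd: "cmod (Q t) \<le> P" for t
    by (rule LIMSEQ_le_const2[OF tendsto_norm[OF lim]]) (use DP in auto)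
  have mom: "(\<lambda>N. moment z (?D N)) \<longlonglongrightarrow> moment z Q" for z
  proof -
    have "moment z Q = moment z \<psi> + moment z S"
      unfolding moment_def Q_def distrib_left
      by (rule Bochner_Integration.integral_add) (rule cont_supp_integrable[OF \<psi>T], rule cont_supp_integrable[OF S(1)])
    moreover have "(\<lambda>N. moment z \<psi> + (\<Sum>i<N. moment z (\<phi> i))) \<longlonglongrightarrow> moment z \<psi> + moment z S"
      using S(3)[of z] unfolding sums_def by (intro tendsto_add tendsto_const)
    moreover have "moment z (\<phi> i) = moment z (?D (Suc i)) - moment z (?D i)" for i
      unfolding \<phi>_def by (rule moment_diff[OF delay_filter_cont_supp_T[OF \<psi>] delay_filter_cont_supp_T[OF \<psi>]])
    then have "moment z \<psi> + (\<Sum>i<N. moment z (\<phi> i)) = moment z (?D N)" for N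
      using sum_lessThan_telescope[of "\<lambda>n. moment z (?D n)" N] by (simp del: delay_filter.simps(2))
    ultimately show ?thesis by simp
  qed
  have "moment (\<mu> n) Q = 0" if "n \<noteq> m" for n
  proof (rule LIMSEQ_unique[OF mom])
    \<comment> \<open>Once \<open>N > n\<close>, the factor with index \<open>n\<close> is
      \<open>1 - exp 0\<close>, so these moments are eventually zero.\<close>
    have "moment (\<mu> n) (?D N) = 0" if N: "N \<ge> Suc n" for N
    proof -
      have "(\<Prod>i\<in>{..<N}-{m}. 1 - exp ((\<mu> n - \<mu> i) * of_real (\<delta> i))) = 0"
        by (rule prod_zero) (use N \<open>n \<noteq> m\<close> in \<open>auto intro!: bexI[of _ n]\<close>)
      then show ?thesis unfolding moment_delay_filter[OF \<psi>] by simp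
    qed
    then show "(\<lambda>N. moment (\<mu> n) (?D N)) \<longlonglongrightarrow> 0"
      by (intro tendsto_eventually) (auto simp: eventually_sequentially)
  qed
  moreover note mom[of "\<mu> m", unfolded moment_delay_filter[OF \<psi>]]
  ultimately show ?thesis using Qsupp Qbd unfolding P_def by blast
qed

text \<open>The seed for index \<open>m\<close> is \<open>exp (- \<mu> m * t)\<close> times a bump
  living on [T/4, T/2]: it has moment \<open>J\<close> at \<open>\<mu> m\<close> and size of order
  \<open>exp (- Re (\<mu> m) * T / 4)\<close>. Normalising the filtered seed costs a factor of order
  \<open>exp (Re (\<mu> m) * T / 8)\<close>; the remaining decay is exactly the weight in the
  assumption, so the series of biorthogonal functions with coefficients \<open>d\<close>
  converges.\<close>

theorem moment_problem:
  fixes d :: "nat \<Rightarrow> complex"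
  assumes d: "summable (\<lambda>n. cmod (d n) * exp (- (Re (\<mu> n) * T / 8)))"
  shows "\<exists>g. cont_supp T g \<and> (\<forall>n. moment (\<mu> n) g = d n)"
proof -
  define \<theta> :: "real \<Rightarrow> real" where "\<theta> t = max 0 ((t - T/4) * (T/2 - t))" for t
  define J where "J = (LINT t|lborel. \<theta> t)"
  have \<theta>0: "0 \<le> \<theta> t" for t by (simp add: \<theta>_def)
  have \<theta>out: "\<theta> t = 0" if "t \<notin> {T/4..T/2}" for t
    using that T_pos by (auto simp: \<theta>_def max_def mult_le_0_iff zero_le_mult_iff)
  have \<theta>cont: "continuous_on A \<theta>" for A
    unfolding \<theta>_def by (intro continuous_intros)
  have \<theta>le: "\<theta> t \<le> T\<^sup>2" for t
  proof (cases "t \<in> {T/4..T/2}")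
    case True
    then have "(t - T/4) * (T/2 - t) \<le> T * T" by (intro mult_mono) (use T_pos in auto)
    then show ?thesis using T_pos by (simp add: \<theta>_def power2_eq_square)
  qed (simp add: \<theta>out)
  have \<theta>int: "integrable lborel \<theta>"
  proof -
    have "set_integrable lborel {0..T} \<theta>" by (rule borel_integrable_atLeastAtMost'[OF \<theta>cont])
    moreover have "indicator {0..T} t *\<^sub>R \<theta> t = \<theta> t" for t
      using \<theta>out[of t] T_pos by (cases "t \<in> {0..T}") auto
    ultimately show ?thesis unfolding set_integrable_def by (simp only:)
  qed
  have J: "0 < J"
  proof -
    \<comment> \<open>On [5T/16, 6T/16] both factors of the bump are at least T/16.\<close>
    let ?c = "(T/16)\<^sup>2"
    have "0 < ?c * (T/16)" using T_pos by simp
    also have "?c * (T/16) = (LINT t|lborel. ?c * indicator {5*T/16..6*T/16} t)"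
      using T_pos by simp
    also have "\<dots> \<le> J" unfolding J_def
    proof (rule integral_mono[OF _ \<theta>int])
      fix t
      show "?c * indicator {5*T/16..6*T/16} t \<le> \<theta> t"
      proof (cases "t \<in> {5*T/16..6*T/16}")
        case True
        then have "(T/16) * (T/16) \<le> (t - T/4) * (T/2 - t)" by (intro mult_mono) (use T_pos in auto)
        then show ?thesis using True by (simp add: \<theta>_def power2_eq_square)
      qed (simp add: \<theta>0)
    qed (intro integrable_mult_right integrable_real_indicator, auto simp: emeasure_lborel_Icc_eq)
    finally show ?thesis .
  qed
  \<comment> \<open>The rate \<open>T / 8\<close> spends half of the decay \<open>T / 4\<close> of
    the seeds.\<close>
  obtain c where c: "c > 0" "\<And>m N. c * exp (- (T/8) * Re (\<mu> m)) \<le> cmod (\<Prod>n\<in>{..<N}-{m}. 1 - exp ((\<mu> m - \<mu> n) * of_real (\<delta> n)))"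
    using gap_product[of "T/8"] T_pos by auto
  define P where "P = exp (\<Sum>n. exp (- (Re (\<mu> n) * \<delta> n / 2)))"
  have "\<exists>Q. cont_supp T Q \<and> (\<forall>t. cmod (Q t) \<le> T\<^sup>2 * exp (- (Re (\<mu> m) * T / 4)) * P) \<and>
     (\<forall>n. n \<noteq> m \<longrightarrow> moment (\<mu> n) Q = 0) \<and> c * exp (- (T/8) * Re (\<mu> m)) * J \<le> cmod (moment (\<mu> m) Q)" for m
  proof -
    define \<psi> where "\<psi> = (\<lambda>t. exp (- \<mu> m * of_real t) * of_real (\<theta> t))"
    have \<psi>: "cont_supp (T/2) \<psi>"
      using \<theta>out T_pos by (auto simp: cont_supp_def \<psi>_def intro!: continuous_intros \<theta>cont)
    have bd: "cmod (\<psi> t) \<le> T\<^sup>2 * exp (- (Re (\<mu> m) * T / 4))" for t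
    proof (cases "t \<in> {T/4..T/2}")
      case True
      then have "exp (- (Re (\<mu> m) * t)) \<le> exp (- (Re (\<mu> m) * T / 4))"
        using mult_left_mono[of "T/4" t "Re (\<mu> m)"] Re_nonneg[of m] by simp
      then have "exp (- (Re (\<mu> m) * t)) * \<theta> t \<le> exp (- (Re (\<mu> m) * T / 4)) * T\<^sup>2"
        by (intro mult_mono \<theta>le \<theta>0) auto
      then show ?thesis using \<theta>0[of t] by (simp add: \<psi>_def norm_mult mult.commute)
    qed (simp add: \<psi>_def \<theta>out)
    have mo: "moment (\<mu> m) \<psi> = of_real J"
    proof -
      have "moment (\<mu> m) \<psi> = (LINT t|lborel. of_real (\<theta> t))"
        unfolding moment_def \<psi>_def by (rule Bochner_Integration.integral_cong) (auto simp: exp_minus)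
      then show ?thesis by (simp add: J_def)
    qed
    obtain Q where Q: "cont_supp T Q" "\<And>t. cmod (Q t) \<le> T\<^sup>2 * exp (- (Re (\<mu> m) * T / 4)) * P"
       "\<And>n. n \<noteq> m \<Longrightarrow> moment (\<mu> n) Q = 0"
       "(\<lambda>N. (\<Prod>n\<in>{..<N}-{m}. 1 - exp ((\<mu> m - \<mu> n) * of_real (\<delta> n))) * of_real J) \<longlonglongrightarrow> moment (\<mu> m) Q"
      using biorthogonal_function[OF \<psi> bd, of m] unfolding mo P_def by blast
    have "c * exp (- (T/8) * Re (\<mu> m)) * J \<le> cmod (moment (\<mu> m) Q)"
    proof (rule LIMSEQ_le_const[OF tendsto_norm[OF Q(4)]], intro exI allI impI)
      fix N
      show "c * exp (- (T/8) * Re (\<mu> m)) * J \<le> norm ((\<Prod>n\<in>{..<N}-{m}. 1 - exp ((\<mu> m - \<mu> n) * of_real (\<delta> n))) * of_real J)"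
        using mult_right_mono[OF c(2)[of m N], of J] J by (simp add: norm_mult)
    qed
    with Q show ?thesis by blast
  qed
  then obtain Q where Q: "\<And>m. cont_supp T (Q m)" "\<And>m t. cmod (Q m t) \<le> T\<^sup>2 * exp (- (Re (\<mu> m) * T / 4)) * P"
     "\<And>m n. n \<noteq> m \<Longrightarrow> moment (\<mu> n) (Q m) = 0" "\<And>m. c * exp (- (T/8) * Re (\<mu> m)) * J \<le> cmod (moment (\<mu> m) (Q m))"
    by metis
  define M where "M m = moment (\<mu> m) (Q m)" for m
  have M: "c * exp (- (T/8) * Re (\<mu> m)) * J \<le> cmod (M m)" for m using Q(4) by (simp add: M_def)
  have M0: "M m \<noteq> 0" for m
  proof -
    have "0 < c * exp (- (T/8) * Re (\<mu> m)) * J" using c J by simp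
    then show ?thesis using M[of m] by auto
  qed
  define \<phi> where "\<phi> = (\<lambda>m t. d m / M m * Q m t)"
  have supp: "cont_supp T (\<phi> m)" for m
    using Q(1)[of m] M0[of m] by (auto simp: cont_supp_def \<phi>_def intro!: continuous_intros)
  have bd: "cmod (\<phi> m t) \<le> cmod (d m) * exp (- (Re (\<mu> m) * T / 8)) * (T\<^sup>2 * P / (c * J))" for m t
  proof -
    have "cmod (\<phi> m t) = cmod (d m) * cmod (Q m t) / cmod (M m)"
      by (simp add: \<phi>_def norm_mult norm_divide)
    also have "\<dots> \<le> cmod (d m) * (T\<^sup>2 * exp (- (Re (\<mu> m) * T / 4)) * P) / (c * exp (- (T/8) * Re (\<mu> m)) * J)"
      by (intro frac_le mult_left_mono Q(2) M) (use c J in \<open>auto simp: P_def\<close>)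
    also have "\<dots> = cmod (d m) * (exp (- (Re (\<mu> m) * T / 4)) / exp (- (T/8) * Re (\<mu> m))) * (T\<^sup>2 * P / (c * J))"
      by (simp add: mult_ac)
    also have "exp (- (Re (\<mu> m) * T / 4)) / exp (- (T/8) * Re (\<mu> m)) = exp (- (Re (\<mu> m) * T / 8))"
      by (simp flip: exp_diff)
    finally show ?thesis .
  qed
  note S = moment_suminf[OF supp bd summable_mult2[OF d]]
  have "moment (\<mu> n) (\<lambda>t. \<Sum>m. \<phi> m t) = d n" for n
  proof -
    have "moment (\<mu> n) (\<phi> m) = (if m = n then d n else 0)" for m
      unfolding \<phi>_def moment_cmult using Q(3)[of n m] M0[of n] by (auto simp: M_def)
    then have "(\<lambda>m. if m = n then d n else 0) sums moment (\<mu> n) (\<lambda>t. \<Sum>m. \<phi> m t)"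
      using S(3)[of "\<mu> n"] by simp
    moreover have "(\<lambda>m. if m = n then d n else 0) sums d n" by (rule sums_single)
    ultimately show ?thesis by (rule sums_unique2)
  qed
  then show ?thesis using S(1) by blast
qed

end

section \<open>Eigenvalues of the Fourier modes\<close>

text \<open>\<open>ua\<close> and \<open>vb\<close> are the diagonal entries of the mode matrix
  \<open>M\<close>, whose off-diagonal entries are both \<open>\<i> * k\<close>; a mode evolves by
  x' = - M x plus forcing.\<close>

definition ua :: "int \<Rightarrow> complex" where
  "ua k = of_int k ^ 4 + \<i> * of_int k ^ 3 - (of_int k ^ 2)"

definition vb :: "int \<Rightarrow> complex" where
  "vb k = of_int k ^ 2 - \<i> * of_int k"

lemma ua_vb_parts:
  "Re (ua k) = of_int (k ^ 4 - k ^ 2)" "Im (ua k) = of_int (k ^ 3)"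
  "Re (vb k) = of_int (k ^ 2)" "Im (vb k) = - of_int k"
proof -
  have "of_int k ^ n = complex_of_real (of_int k ^ n)" for n by simp
  then show "Re (ua k) = of_int (k ^ 4 - k ^ 2)" "Im (ua k) = of_int (k ^ 3)"
    "Re (vb k) = of_int (k ^ 2)" "Im (vb k) = - of_int k"
    unfolding ua_def vb_def by (simp_all only: complex_Re_of_int) simp_all
qed

lemma ua_minus: "ua (- k) = cnj (ua k)" and vb_minus: "vb (- k) = cnj (vb k)"
  by (simp_all add: complex_eq_iff ua_vb_parts)

text \<open>The real part \<open>k^4 - 2 * k^2\<close> alone suffices from \<open>k = 3\<close> on;
  at \<open>k = 2\<close> it is only 8 and the imaginary part 10 is needed as well. The coefficient
  \<open>5/2\<close> produces the radius \<open>2/5\<close> in \<open>offset_pos\<close>, where the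
  extra \<open>k\<close> pays for a first crude bound.\<close>

lemma norm_ua_minus_vb:
  assumes "2 \<le> k"
  shows "5/2 * of_int k ^ 2 + of_int k \<le> cmod (ua k - vb k)"
proof (cases "k = 2")
  case True
  then have "ua k - vb k = Complex 8 10" by (simp add: complex_eq_iff ua_vb_parts)
  moreover have "12 \<le> cmod (Complex 8 10)" by (simp add: cmod_def real_le_rsqrt)
  ultimately show ?thesis using True by simp
next
  case False
  define x where "x = real_of_int k"
  have x: "3 \<le> x" using False assms by (simp add: x_def)
  have "x * 3 \<le> x * x" using x by (intro mult_left_mono) auto
  then have x1: "3 * x \<le> x ^ 2" by (simp add: power2_eq_square)
  then have x2: "9 \<le> x ^ 2" using x by linarith
  have "x^2 * 9 \<le> x^2 * x^2" using x2 by (intro mult_left_mono) auto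
  then have "9 * x^2 \<le> x ^ 4" by (simp flip: power_add)
  then have "5/2 * x ^ 2 + x \<le> Re (ua k - vb k)" using x1 x2 x by (simp add: ua_vb_parts flip: x_def)
  then show ?thesis using complex_Re_le_cmod[of "ua k - vb k"] by (simp add: x_def)
qed

text \<open>At \<open>k = 1\<close> the diagonal entries are too close for the general estimate, so
  the quadratic is solved explicitly. The positive real part is what separates modes 1 and -1 from
  the eigenvalue 0 of mode 0, since \<open>Re (ua 1) = 0\<close>.\<close>

lemma offset_one:
  "\<exists>e. e * (e + ua 1 - vb 1) = -1 \<and> cmod e \<le> 2/5 \<and> 1/10 \<le> Re e"
proof -
  \<comment> \<open>The discriminant is (-1 + 2i)^2 - 4 = -7 - 4i, with square root p - iq: p^2 -
    q^2 = -7, p q = 2 and p^2 + q^2 = sqrt 65.\<close>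
  define p q where "p = sqrt ((sqrt 65 - 7) / 2)" and "q = sqrt ((sqrt 65 + 7) / 2)"
  have s: "8.06 < sqrt 65" "sqrt 65 < 8.063"
    by (rule real_less_rsqrt, simp add: power2_eq_square) (rule real_less_lsqrt, auto simp: power2_eq_square)
  have p: "p\<^sup>2 = (sqrt 65 - 7) / 2" and q: "q\<^sup>2 = (sqrt 65 + 7) / 2" using s by (auto simp: p_def q_def)
  have pq: "p * q = 2"
  proof -
    have "(sqrt 65 - 7) / 2 * ((sqrt 65 + 7) / 2) = 4" by (simp add: field_simps)
    then have "p * q = sqrt 4" unfolding p_def q_def by (simp only: flip: real_sqrt_mult)
    then show ?thesis by simp
  qed
  have pl: "0.728 \<le> p" and pu: "p \<le> 0.8" and ql: "2 \<le> q" and qu: "q \<le> 2.745"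
  proof -
    show "0.728 \<le> p" unfolding p_def by (rule real_le_rsqrt) (use s in \<open>simp add: power2_eq_square\<close>)
    show "2 \<le> q" unfolding q_def by (rule real_le_rsqrt) (use s in \<open>simp add: power2_eq_square\<close>)
    have "p\<^sup>2 \<le> 0.8\<^sup>2" "q\<^sup>2 \<le> 2.745\<^sup>2" using p q s by (simp_all add: power2_eq_square)
    then show "p \<le> 0.8" "q \<le> 2.745"
      using power2_le_imp_le[of p "0.8"] power2_le_imp_le[of q "2.745"] by simp_all
  qed
  define e where "e = Complex ((1 - p) / 2) ((q - 2) / 2)"
  have ab: "ua 1 - vb 1 = Complex (-1) 2" by (simp add: complex_eq_iff ua_vb_parts)
  have "e * (e + (ua 1 - vb 1)) = -1"
    unfolding ab e_def complex_eq_iff using pq p q s by (simp add: field_simps power2_eq_square)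
  moreover have "cmod e \<le> 2/5"
  proof -
    have "(1 - p)^2 \<le> 0.272^2" "(q - 2)^2 \<le> 0.745^2" using pl pu ql qu by (auto intro!: power_mono)
    then have "((1 - p) / 2)^2 + ((q - 2) / 2)^2 \<le> (2/5)^2" by (simp add: power2_eq_square power_divide)
    then have "(cmod e)\<^sup>2 \<le> (2/5)\<^sup>2" by (simp add: e_def cmod_power2)
    then show ?thesis by (rule power2_le_imp_le) simp
  qed
  moreover have "1/10 \<le> Re e" using pu by (simp add: e_def)
  ultimately show ?thesis by (auto simp: algebra_simps)
qed

text \<open>For \<open>k \<ge> 2\<close> the quadratic has root sum \<open>- D\<close> and root
  product \<open>k^2\<close>, with \<open>D = ua k - vb k\<close>. The smaller root has modulus at
  most \<open>k\<close>, so the larger one has modulus at least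
  \<open>|D| - k \<ge> 5/2 * k^2\<close>; dividing the product by it improves the bound on the
  smaller root to \<open>2/5\<close>.\<close>

lemma offset_pos:
  assumes "1 \<le> k"
  shows "\<exists>e. e * (e + ua k - vb k) = - (of_int k ^ 2) \<and> cmod e \<le> 2/5 \<and> (k = 1 \<longrightarrow> 1/10 \<le> Re e)"
proof (cases "k = 1")
  case True
  then show ?thesis using offset_one by auto
next
  case False
  then have k: "2 \<le> k" using assms by simp
  define D where "D = ua k - vb k"
  define x where "x = real_of_int k"
  have x: "2 \<le> x" using k by (simp add: x_def)
  have D: "5/2 * x^2 + x \<le> cmod D" using norm_ua_minus_vb[OF k] by (simp add: D_def x_def)
  define s where "s = csqrt (D\<^sup>2 - 4 * of_int k ^ 2)"
  have s: "s\<^sup>2 = D\<^sup>2 - 4 * of_int k ^ 2" by (simp add: s_def)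
  have eq: "e * (e + D) = - (of_int k ^ 2)" "e' = - D - e \<Longrightarrow> e * e' = of_int k ^ 2" if "e = (- D + s) / 2 \<or> e = (- D - s) / 2" for e e'
  proof -
    have "e * (e + D) = (s\<^sup>2 - D\<^sup>2) / 4" using that
      by (elim disjE) (simp_all only:, simp_all add: field_simps power2_eq_square)
    then show *: "e * (e + D) = - (of_int k ^ 2)" using s by simp
    show "e' = - D - e \<Longrightarrow> e * e' = of_int k ^ 2"
    proof -
      have "e * (- D - e) = - (e * (e + D))" by (simp add: algebra_simps)
      then show "e' = - D - e \<Longrightarrow> e * e' = of_int k ^ 2" using * by simp
    qed
  qed
  have "\<exists>e. (e = (- D + s) / 2 \<or> e = (- D - s) / 2) \<and> cmod e \<le> cmod (- D - e)"
  proof (cases "cmod ((- D + s) / 2) \<le> cmod ((- D - s) / 2)")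
    case True
    moreover have "- D - (- D + s) / 2 = (- D - s) / 2" by (simp add: field_simps)
    ultimately show ?thesis by metis
  next
    case False
    moreover have "- D - (- D - s) / 2 = (- D + s) / 2" by (simp add: field_simps)
    ultimately show ?thesis by (metis linear)
  qed
  then obtain e where e: "e = (- D + s) / 2 \<or> e = (- D - s) / 2" "cmod e \<le> cmod (- D - e)" by blast
  have "e * (- D - e) = of_int k ^ 2" using eq(2)[OF e(1)] by blast
  then have "cmod (e * (- D - e)) = cmod (of_int k ^ 2)" by simp
  then have prod: "cmod e * cmod (- D - e) = x ^ 2" by (simp add: norm_mult norm_power x_def)
  have "cmod e * cmod e \<le> x ^ 2" using mult_left_mono[OF e(2), of "cmod e"] prod by simp
  then have ex: "cmod e \<le> x"
    using x power2_le_imp_le[of "cmod e" x] by (simp add: power2_eq_square)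
  have "cmod D \<le> cmod (- D - e) + cmod e"
    using norm_triangle_ineq[of "- D - e" e] by simp
  then have "5/2 * x^2 \<le> cmod (- D - e)" using D ex by linarith
  then have "cmod e * (5/2 * x^2) \<le> x^2"
    using mult_left_mono[of "5/2 * x^2" "cmod (- D - e)" "cmod e"] prod by simp
  then have "(cmod e * (5/2)) * x^2 \<le> 1 * x^2" by (simp add: algebra_simps)
  then have "cmod e * (5/2) \<le> 1" by (rule mult_right_le_imp_le) (use x in simp)
  then show ?thesis using eq(1)[OF e(1)] False by (intro exI[of _ e]) (auto simp: D_def algebra_simps)
qed

text \<open>The eigenvalues of mode \<open>k\<close> are \<open>ua k + e k\<close> and \<open>vb k - e k\<close>, since they sum to \<open>ua k + vb k\<close>.\<close>

definition is_offset :: "(int \<Rightarrow> complex) \<Rightarrow> bool" where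
  "is_offset e \<longleftrightarrow> (\<forall>k. k \<noteq> 0 \<longrightarrow> e k * (e k + ua k - vb k) = - (of_int k ^ 2)) \<and> (\<forall>k. cmod (e k) \<le> 2/5) \<and>
     (\<forall>k. e (- k) = cnj (e k)) \<and> e 0 = 0 \<and> 1/10 \<le> Re (e 1)"

text \<open>Negative modes take the conjugates of the roots chosen for positive ones, which is
  consistent because \<open>ua\<close> and \<open>vb\<close> are conjugated under
  \<open>k \<mapsto> - k\<close>.\<close>

lemma offset_exists: "\<exists>e. is_offset e"
proof -
  obtain h where h: "\<And>k. 1 \<le> k \<Longrightarrow> h k * (h k + ua k - vb k) = - (of_int k ^ 2) \<and> cmod (h k) \<le> 2/5 \<and> (k = 1 \<longrightarrow> 1/10 \<le> Re (h k))"
    using offset_pos by metis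
  define e where "e k = (if 1 \<le> k then h k else if k = 0 then 0 else cnj (h (- k)))" for k :: int
  have "e k * (e k + ua k - vb k) = - (of_int k ^ 2)" if k: "k \<noteq> 0" for k
  proof (cases "1 \<le> k")
    case True
    then show ?thesis using h by (simp add: e_def)
  next
    case False
    then have "cnj (h (-k) * (h (-k) + ua (-k) - vb (-k))) = cnj (- (of_int (-k) ^ 2))"
      using h[of "-k"] k by simp
    then show ?thesis using False k by (simp add: e_def ua_minus vb_minus)
  qed
  moreover have "cmod (e k) \<le> 2/5" for k using h[of k] h[of "-k"] by (auto simp: e_def)
  moreover have "e (- k) = cnj (e k)" for k by (auto simp: e_def)
  ultimately show ?thesis using h[of 1] unfolding is_offset_def by (intro exI[of _ e]) (auto simp: e_def)
qed

text \<open>Mode 0 contributes the single eigenvalue 0; the index \<open>(0, False)\<close> is a dummy, given the value 2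
  so as to stay separated from the spectrum.\<close>

definition eigval :: "(int \<Rightarrow> complex) \<Rightarrow> int \<times> bool \<Rightarrow> complex" where
  "eigval e p = (case p of (k, True) \<Rightarrow> ua k + e k | (k, False) \<Rightarrow> if k = 0 then 2 else vb k - e k)"

lemma eigval_simps [simp]: "eigval e (k, True) = ua k + e k"
  "k \<noteq> 0 \<Longrightarrow> eigval e (k, False) = vb k - e k" "eigval e (0, False) = 2"
  by (simp_all add: eigval_def)

text \<open>The characteristic equation of the mode matrix; the right side is
  \<open>(\<i> * k)^2\<close>.\<close>

lemma eigval_char:
  assumes "is_offset e" "k \<noteq> 0"
  shows "(eigval e (k, b) - ua k) * (eigval e (k, b) - vb k) = - (of_int k ^ 2)"
  using assms by (cases b) (auto simp: is_offset_def algebra_simps)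

text \<open>The two offsets cost at most 4/5 of the distance between the diagonal entries. The size
  \<open>k^2\<close>, rather than a constant, is what lets \<open>mode_exists\<close> gain one power
  of \<open>k\<close>.\<close>

lemma eigval_diff:
  assumes e: "is_offset e" and k: "k \<noteq> 0"
  shows "of_int k ^ 2 \<le> cmod (eigval e (k, True) - eigval e (k, False))"
proof -
  have pos: "of_int k ^ 2 \<le> cmod (ua k - vb k) - 4/5" if "1 \<le> k" for k :: int
  proof (cases "k = 1")
    case True
    then have "ua k - vb k = Complex (-1) 2" by (simp add: complex_eq_iff ua_vb_parts)
    moreover have "9/5 \<le> cmod (Complex (-1) 2)" unfolding cmod_def by (rule real_le_rsqrt) (simp add: power2_eq_square)
    ultimately show ?thesis using True by simp
  next
    case False
    then have "2 \<le> k" using that by simp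
    then show ?thesis using norm_ua_minus_vb[of k] zero_le_power2[of "real_of_int k"] of_int_le_iff[of 2 k, where ?'a = real]
      unfolding of_int_numeral by linarith
  qed
  have "of_int k ^ 2 \<le> cmod (ua k - vb k) - 4/5"
  proof (cases "1 \<le> k")
    case False
    then show ?thesis using pos[of "-k"] k by (simp add: ua_minus vb_minus flip: complex_cnj_diff)
  qed (rule pos)
  moreover have "eigval e (k, True) - eigval e (k, False) = (ua k - vb k) - (- 2 * e k)" using k by simp
  moreover have "cmod (- 2 * e k) \<le> 4/5" using e by (simp add: is_offset_def norm_mult mult.commute)
  ultimately show ?thesis using norm_triangle_ineq2[of "ua k - vb k" "- 2 * e k"] by (simp only:)
qed

section \<open>Separation of the real parts by integer arithmetic\<close>

lemma int_square_neq_two: "(k::int)\<^sup>2 \<noteq> 2"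
proof
  assume k: "k\<^sup>2 = 2"
  show False
  proof (cases "\<bar>k\<bar> \<le> 1")
    case True
    then have "k = 0 \<or> k = 1 \<or> k = -1" by linarith
    then show False using k by auto
  next
    case False
    then have "2\<^sup>2 \<le> \<bar>k\<bar>\<^sup>2" by (intro power_mono) auto
    then show False using k by simp
  qed
qed

text \<open>With \<open>x = k^2 > 1\<close>, the number \<open>x * (x - 1)\<close> lies strictly
  between the consecutive squares \<open>(x - 1)^2\<close> and \<open>x^2\<close>.\<close>

lemma quartic_neq_square:
  fixes k m :: int
  assumes "m \<noteq> 0"
  shows "k ^ 4 - k\<^sup>2 \<noteq> m\<^sup>2"
proof
  assume eq: "k ^ 4 - k\<^sup>2 = m\<^sup>2"
  define x where "x = k\<^sup>2"
  have x: "x * (x - 1) = m\<^sup>2" using eq by (simp add: x_def algebra_simps power2_eq_square power4_eq_xxxx)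
  have m: "0 < m\<^sup>2" using assms by simp
  have "0 \<le> x" by (simp add: x_def)
  have "1 < x" using x m \<open>0 \<le> x\<close> by (smt (verit) mult_nonneg_nonpos)
  have "m\<^sup>2 = x\<^sup>2 - x" "(x - 1)\<^sup>2 = x\<^sup>2 - 2 * x + 1"
    using x by (simp_all add: power2_eq_square algebra_simps)
  then have "(x - 1)\<^sup>2 < m\<^sup>2" "m\<^sup>2 < x\<^sup>2" using \<open>1 < x\<close> by linarith+
  then have "(x - 1)\<^sup>2 < \<bar>m\<bar>\<^sup>2" "\<bar>m\<bar>\<^sup>2 < x\<^sup>2" by auto
  then have "x - 1 < \<bar>m\<bar>" "\<bar>m\<bar> < x"
    using \<open>1 < x\<close> power2_less_imp_less by (smt (verit) abs_ge_zero)+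
  then show False by simp
qed

lemma quartic_neq_two: "(k::int) ^ 4 - k\<^sup>2 \<noteq> 2"
proof
  assume "k ^ 4 - k\<^sup>2 = 2"
  then have "(k\<^sup>2 - 2) * (k\<^sup>2 + 1) = 0" by (simp add: algebra_simps power2_eq_square power4_eq_xxxx)
  then show False using int_square_neq_two[of k] zero_le_power2[of k] by auto
qed

text \<open>The difference of the two sides factors as
  \<open>(k^2 - m^2) * (k^2 + m^2 - 1)\<close>.\<close>

lemma quartic_eq_cases:
  fixes k m :: int
  assumes "k ^ 4 - k\<^sup>2 = m ^ 4 - m\<^sup>2"
  shows "m = k \<or> m = - k \<or> (k = 0 \<and> \<bar>m\<bar> = 1) \<or> (m = 0 \<and> \<bar>k\<bar> = 1)"
proof -
  have "(k\<^sup>2 - m\<^sup>2) * (k\<^sup>2 + m\<^sup>2 - 1) = 0" using assms by (simp add: algebra_simps power2_eq_square power4_eq_xxxx)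
  then consider "m\<^sup>2 = k\<^sup>2" | "k\<^sup>2 + m\<^sup>2 = 1" by force
  then show ?thesis
  proof cases
    case 1
    then show ?thesis by (auto simp: power2_eq_iff)
  next
    case 2
    then have "k\<^sup>2 \<le> 1" "m\<^sup>2 \<le> 1" using zero_le_power2[of k] zero_le_power2[of m] by linarith+
    then have "\<bar>k\<bar> \<le> 1" "\<bar>m\<bar> \<le> 1" by (simp_all add: abs_square_le_1)
    then have "k = 0 \<or> k = 1 \<or> k = -1" "m = 0 \<or> m = 1 \<or> m = -1" by linarith+
    then show ?thesis using 2 by auto
  qed
qed

text \<open>Real parts lie within \<open>2/5\<close> of integers, so distinct integers leave a gap
  of \<open>1/5\<close>. Apart from conjugate pairs, equal integers occur only in the quartic
  branch, between mode 0 and modes 1 and -1; there \<open>Re (e 1) \<ge> 1/10\<close> provides the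
  gap.\<close>

lemma eigval_Re_sep:
  assumes e: "is_offset e" and ne: "(k, b) \<noteq> (m, c)" and conj: "\<not> (m = - k \<and> b = c)"
  shows "1/10 \<le> \<bar>Re (eigval e (k, b) - eigval e (m, c))\<bar>"
proof -
  define N :: "int \<times> bool \<Rightarrow> int" where
    "N p = (case p of (k, True) \<Rightarrow> k ^ 4 - k\<^sup>2 | (k, False) \<Rightarrow> if k = 0 then 2 else k\<^sup>2)" for p
  have Re_e: "\<bar>Re (e k)\<bar> \<le> 2/5" for k
    using e abs_Re_le_cmod[of "e k"] unfolding is_offset_def by (meson order_trans)
  have off: "\<bar>Re (eigval e p) - of_int (N p)\<bar> \<le> 2/5" for p
  proof (cases p)
    case (Pair k b)
    then show ?thesis using Re_e[of k] by (cases b; cases "k = 0") (auto simp: N_def ua_vb_parts)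
  qed
  show ?thesis
  proof (cases "N (k, b) = N (m, c)")
    case False
    then have "1 \<le> \<bar>N (k, b) - N (m, c)\<bar>" by linarith
    then have "1 \<le> \<bar>real_of_int (N (k, b)) - real_of_int (N (m, c))\<bar>"
      by (metis of_int_1_le_iff of_int_abs of_int_diff)
    then show ?thesis using off[of "(k, b)"] off[of "(m, c)"] by (simp only: minus_complex.simps)
  next
    case True
    have e1: "1/10 \<le> Re (e k)" if "\<bar>k\<bar> = 1" for k
    proof -
      have "k = 1 \<or> k = - 1" using that by linarith
      then show ?thesis using e unfolding is_offset_def by (metis complex_cnj(1) cnj.sel(1))
    qed
    have e0: "e 0 = 0" using e by (simp add: is_offset_def)
    have ua1: "Re (ua k) = 0" if "\<bar>k\<bar> = 1" for k
      using that by (auto simp: ua_vb_parts abs_if split: if_splits)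
    show ?thesis
    proof (cases b; cases c)
      assume bc: b c
      then have "k ^ 4 - k\<^sup>2 = m ^ 4 - m\<^sup>2" using True by (simp add: N_def)
      then have "(k = 0 \<and> \<bar>m\<bar> = 1) \<or> (m = 0 \<and> \<bar>k\<bar> = 1)"
        using quartic_eq_cases[of k m] ne conj bc by auto
      then show ?thesis using e1[of m] e1[of k] ua1[of k] ua1[of m] e0 bc by (auto simp: ua_vb_parts)
    next
      assume "b" "\<not> c"
      then show ?thesis using True quartic_neq_square[of m k] quartic_neq_two[of k] by (auto simp: N_def split: if_splits)
    next
      assume "\<not> b" "c"
      then show ?thesis using True quartic_neq_square[of k m] quartic_neq_two[of m] by (auto simp: N_def split: if_splits)
    next
      assume "\<not> b" "\<not> c"
      then show ?thesis using True ne conj int_square_neq_two[of k] int_square_neq_two[of m]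
        by (auto simp: N_def power2_eq_iff split: if_splits)
    qed
  qed
qed

section \<open>Weights and growth of the eigenvalues\<close>

definition wt :: "int \<Rightarrow> real" where "wt k = 1 + \<bar>of_int k\<bar>"

lemma wt_ge_1: "1 \<le> wt k" and wt_pos: "0 < wt k" by (simp_all add: wt_def)

text \<open>The constants are loose enough to include the small modes. At \<open>|k| = 1\<close> the
  real part of \<open>ua k\<close> is 0 and nonnegativity rests on
  \<open>Re (e 1) \<ge> 1/10\<close>; for \<open>|k| \<ge> 2\<close> it suffices that
  \<open>1 + |k| \<le> 3/2 * |k|\<close> and \<open>k^4 \<ge> 4 * k^2\<close>.\<close>

lemma eigval_Re_nonneg:
  assumes "is_offset e"
  shows "0 \<le> Re (eigval e (k, b))"
    and "wt k ^ 2 / 10 - 2 \<le> Re (eigval e (k, b))"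
    and "wt k ^ 4 / 10 - 2 \<le> Re (eigval e (k, True))"
proof -
  define x where "x = \<bar>real_of_int k\<bar>"
  have Re_e: "\<bar>Re (e k)\<bar> \<le> 2/5" for k
    using assms abs_Re_le_cmod[of "e k"] unfolding is_offset_def by (meson order_trans)
  have w: "wt k = 1 + x" by (simp add: wt_def x_def)
  have ev: "Re (ua k + e k) = x ^ 4 - x ^ 2 + Re (e k)" "Re (vb k - e k) = x^2 - Re (e k)"
    by (simp_all add: ua_vb_parts x_def)
  consider "k = 0" | "\<bar>k\<bar> = 1" | "2 \<le> x" unfolding x_def by linarith
  then have "0 \<le> Re (eigval e (k, b)) \<and> wt k ^ 2 / 10 - 2 \<le> Re (eigval e (k, b)) \<and> wt k ^ 4 / 10 - 2 \<le> Re (eigval e (k, True))"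
  proof cases
    case 1
    then show ?thesis using assms by (cases b) (auto simp: wt_def is_offset_def ua_vb_parts)
  next
    case 2
    then have "k = 1 \<or> k = -1" by linarith
    then have e1: "1/10 \<le> Re (e k)" using assms unfolding is_offset_def by (metis cnj.sel(1))
    have x: "x = 1" using 2 by (simp add: x_def flip: of_int_abs)
    show ?thesis using e1 ev 2 Re_e[of k] by (cases b) (auto simp: w x)
  next
    case 3
    then have k: "k \<noteq> 0" by (auto simp: x_def)
    have "1 + x \<le> 3/2 * x" using 3 by simp
    then have p: "(1 + x)^2 \<le> (3/2 * x)^2" "(1 + x)^4 \<le> (3/2 * x)^4" using 3 by (auto intro!: power_mono)
    have x2: "4 \<le> x^2" using power_mono[OF 3, of 2] by simp
    have "4 * x^2 \<le> x^2 * x^2" using x2 by (intro mult_right_mono) auto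
    then have x4: "4 * x^2 \<le> x^4" by (simp flip: power_add)
    show ?thesis using ev k Re_e[of k] p x2 x4
      unfolding w power_mult_distrib
      by (cases b) (simp_all add: power_divide del: power_mult_distrib, (intro conjI; linarith)+)
  qed
  then show "0 \<le> Re (eigval e (k, b))"
    and "wt k ^ 2 / 10 - 2 \<le> Re (eigval e (k, b))"
    and "wt k ^ 4 / 10 - 2 \<le> Re (eigval e (k, True))" by auto
qed

lemma eigval_conj:
  assumes "is_offset e" "k \<noteq> 0"
  shows "eigval e (- k, b) = cnj (eigval e (k, b))"
  using assms by (cases b) (auto simp: is_offset_def ua_minus vb_minus)

text \<open>A conjugate pair shares its real part and is separated only by the imaginary part. The
  upper bound guides the choice of delays, which must keep the phase away from the nonzero periods
  of the exponential.\<close>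

lemma eigval_Im:
  assumes "is_offset e" "k \<noteq> 0"
  shows "3/5 \<le> \<bar>Im (eigval e (k, b))\<bar>" "\<bar>Im (eigval e (k, b))\<bar> \<le> wt k ^ (if b then 3 else 1)"
proof -
  define x where "x = \<bar>real_of_int k\<bar>"
  have "1 \<le> \<bar>k\<bar>" using assms(2) by linarith
  then have x: "1 \<le> x" by (simp add: x_def flip: of_int_abs)
  have e: "\<bar>Im (e k)\<bar> \<le> 2/5"
    using assms abs_Im_le_cmod[of "e k"] unfolding is_offset_def by (meson order_trans)
  have i: "\<bar>Im (ua k)\<bar> = x ^ 3" "\<bar>Im (vb k)\<bar> = x"
    by (simp_all add: ua_vb_parts x_def power_abs)
  have w: "wt k = 1 + x" by (simp add: wt_def x_def)
  have x3: "1 \<le> x ^ 3" using x by simp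
  have w3: "x ^ 3 + 1 \<le> (1 + x) ^ 3" using x by (simp add: power3_eq_cube algebra_simps)
  have "3/5 \<le> \<bar>Im (eigval e (k, b))\<bar> \<and> \<bar>Im (eigval e (k, b))\<bar> \<le> wt k ^ (if b then 3 else 1)"
  proof (cases b)
    case True
    then have "Im (eigval e (k, b)) = Im (ua k) + Im (e k)" by simp
    then have "3/5 \<le> \<bar>Im (eigval e (k, b))\<bar>" "\<bar>Im (eigval e (k, b))\<bar> \<le> x ^ 3 + 1"
      using e i x3 by linarith+
    then show ?thesis using w3 True by (simp add: w)
  next
    case False
    then have "Im (eigval e (k, b)) = Im (vb k) - Im (e k)" using assms by simp
    then have "3/5 \<le> \<bar>Im (eigval e (k, b))\<bar>" "\<bar>Im (eigval e (k, b))\<bar> \<le> x + 1"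
      using e i x by linarith+
    then show ?thesis using False by (simp add: w)
  qed
  then show "3/5 \<le> \<bar>Im (eigval e (k, b))\<bar>" "\<bar>Im (eigval e (k, b))\<bar> \<le> wt k ^ (if b then 3 else 1)" by auto
qed

text \<open>Only the modulus of \<open>exp z\<close> is used; the inequality
  \<open>1 + x \<le> exp x\<close> makes it depart from 1 on either side.\<close>

lemma norm_one_minus_exp_Re:
  assumes "y \<le> \<bar>Re z\<bar>" "0 \<le> y" "y \<le> 1"
  shows "y / 2 \<le> cmod (1 - exp z)"
proof (cases "0 \<le> Re z")
  case True
  have "Re z \<le> exp (Re z) - 1" using exp_ge_add_one_self[of "Re z"] by linarith
  also have "\<dots> \<le> cmod (1 - exp z)" using norm_triangle_ineq2[of "exp z" 1] by (simp add: norm_minus_commute)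
  finally show ?thesis using assms True by simp
next
  case False
  have "1 + y \<le> exp (- Re z)" using exp_ge_add_one_self[of "- Re z"] assms False by simp
  then have "exp (Re z) \<le> 1 / (1 + y)" using assms by (simp add: exp_minus field_simps)
  moreover have "1 / (1 + y) \<le> 1 - y / 2"
    using assms mult_left_le[of y y] by (simp add: field_simps)
  ultimately have "y / 2 \<le> 1 - exp (Re z)" by linarith
  also have "\<dots> \<le> cmod (1 - exp z)" using norm_triangle_ineq2[of 1 "exp z"] by simp
  finally show ?thesis .
qed

text \<open>Here \<open>exp z\<close> has modulus 1, so its imaginary part \<open>sin (Im z)\<close>
  has to do the work; the Taylor remainder is at most a sixth of \<open>|Im z|\<close>.\<close>

lemma norm_one_minus_exp_Im:
  assumes "Re z = 0" "\<bar>Im z\<bar> \<le> 1"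
  shows "\<bar>Im z\<bar> / 2 \<le> cmod (1 - exp z)"
proof -
  let ?x = "Im z"
  have "\<bar>sin ?x - (\<Sum>m<3. sin_coeff m * ?x ^ m)\<bar> \<le> inverse (fact 3) * \<bar>?x\<bar> ^ 3"
    by (rule Maclaurin_sin_bound)
  then have "\<bar>sin ?x - ?x\<bar> \<le> \<bar>?x\<bar> ^ 3 / 6"
    by (simp add: sin_coeff_def numeral_3_eq_3 fact_numeral)
  moreover have "\<bar>?x\<bar> ^ 3 \<le> \<bar>?x\<bar> ^ 1" using assms by (intro power_decreasing) auto
  ultimately have "\<bar>?x\<bar> / 2 \<le> \<bar>sin ?x\<bar>" unfolding power_one_right by linarith
  also have "\<dots> = \<bar>Im (1 - exp z)\<bar>" using assms by (simp add: Im_exp)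
  also have "\<dots> \<le> cmod (1 - exp z)" by (rule abs_Im_le_cmod)
  finally show ?thesis .
qed

section \<open>Moments at the eigenvalues\<close>

lemma summable_on_int_even:
  fixes f :: "nat \<Rightarrow> real"
  assumes "summable f" "\<And>n. 0 \<le> f n"
  shows "(\<lambda>k::int. f (nat \<bar>k\<bar>)) summable_on UNIV"
proof -
  have f: "f summable_on UNIV" using assms by (simp add: summable_on_UNIV_nonneg_real_iff)
  have "(\<lambda>k::int. f (nat \<bar>k\<bar>)) summable_on range int"
    by (subst summable_on_reindex) (auto simp: o_def f)
  moreover have "(\<lambda>k::int. f (nat \<bar>k\<bar>)) summable_on range (\<lambda>n. - int n)"
    by (subst summable_on_reindex) (auto simp: o_def f inj_on_def)
  then have "(\<lambda>k::int. f (nat \<bar>k\<bar>)) summable_on {..<0}"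
  proof (rule summable_on_subset_banach)
    show "{..<0} \<subseteq> range (\<lambda>n. - int n)"
      by (auto intro!: image_eqI[of _ _ "nat (- _)"])
  qed
  moreover have "range int \<inter> {..<0} = {}" by auto
  ultimately have "(\<lambda>k::int. f (nat \<bar>k\<bar>)) summable_on (range int \<union> {..<0})"
    by (rule summable_on_Un_disjoint)
  moreover have "range int \<union> {..<0} = UNIV"
    by (auto intro!: image_eqI[of _ _ "nat _"])
  ultimately show ?thesis by simp
qed

text \<open>The exponent is 3/2, hence convergence. Writing it through the square root lets later
  comparisons use integer powers of \<open>sqrt (wt k)\<close>.\<close>

lemma summable_wt: "(\<lambda>k. 1 / sqrt (wt k) ^ 3) summable_on UNIV"
proof -
  have "summable (\<lambda>n. real n powr (-3/2))" by (simp add: summable_real_powr_iff)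
  then have "summable (\<lambda>n. real (Suc n) powr (-3/2))" by (subst summable_Suc_iff)
  moreover have "real (Suc n) powr (-3/2) = 1 / sqrt (1 + real n) ^ 3" for n
  proof -
    have "sqrt (1 + real n) ^ 3 = ((1 + real n) powr (1/2)) powr 3"
      by (simp add: powr_half_sqrt)
    also have "\<dots> = (1 + real n) powr (3/2)" by (simp add: powr_powr)
    finally have "sqrt (1 + real n) ^ 3 = (1 + real n) powr (3/2)" .
    moreover have "(1 + real n) powr (- (3/2)) = 1 / (1 + real n) powr (3/2)" by (rule powr_minus_divide)
    moreover have "real (Suc n) = 1 + real n" "- 3 / 2 = - (3/2 :: real)" by simp_all
    ultimately show ?thesis by (simp only:)
  qed
  ultimately have "summable (\<lambda>n. 1 / sqrt (1 + real n) ^ 3)" by simp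
  from summable_on_int_even[OF this] show ?thesis by (simp add: wt_def)
qed

text \<open>\<open>separated_spectrum\<close> takes sequences. The terms are nonnegative, so any
  enumeration of the countable index set keeps them summable.\<close>

lemma wt_enumeration:
  obtains \<phi> :: "nat \<Rightarrow> int \<times> bool" where "bij \<phi>" "summable (\<lambda>n. 1 / sqrt (wt (fst (\<phi> n))) ^ 3)"
proof -
  let ?f = "\<lambda>p::int \<times> bool. 1 / sqrt (wt (fst p)) ^ 3"
  have "?f summable_on range (\<lambda>k. (k, b))" for b
    by (subst summable_on_reindex) (auto simp: o_def summable_wt inj_on_def)
  moreover have "range (\<lambda>k::int. (k, True)) \<inter> range (\<lambda>k. (k, False)) = {}" by auto
  ultimately have "?f summable_on (range (\<lambda>k. (k, True)) \<union> range (\<lambda>k. (k, False)))"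
    by (intro summable_on_Un_disjoint)
  moreover have "range (\<lambda>k::int. (k, True)) \<union> range (\<lambda>k. (k, False)) = UNIV" by (auto simp: image_iff)
  ultimately have *: "?f summable_on UNIV" by simp
  have inf: "infinite (UNIV :: (int \<times> bool) set)" by (simp add: finite_prod)
  define \<phi> where "\<phi> = from_nat_into (UNIV :: (int \<times> bool) set)"
  have b: "bij \<phi>" unfolding \<phi>_def by (rule bij_betw_from_nat_into[OF _ inf]) simp
  then have "(\<lambda>n. ?f (\<phi> n)) summable_on UNIV" using * summable_on_reindex_bij_betw[of \<phi> UNIV UNIV ?f] by simp
  then have "summable (\<lambda>n. ?f (\<phi> n))"
    by (subst (asm) summable_on_UNIV_nonneg_real_iff) (auto simp: wt_def)
  with b that show ?thesis by blast
qed

lemma exp_minus_le_quartic: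
  assumes "0 < (y::real)"
  shows "exp (- y) \<le> 256 / y ^ 4"
proof -
  have "(y / 4) ^ 4 \<le> exp (y / 4) ^ 4"
    using assms exp_ge_add_one_self[of "y / 4"] by (intro power_mono) linarith+
  also have "\<dots> = exp y" by (simp flip: exp_of_nat_mult)
  finally show ?thesis using assms by (simp add: exp_minus field_simps power_divide)
qed

text \<open>With \<open>s = sqrt wt\<close>, delays of order \<open>s^-3\<close> in the quadratic
  branch and \<open>s^-6\<close> in the quartic branch are summable, yet
  \<open>Re \<mu> * \<delta>\<close> still grows at least like \<open>s\<close>. The factors are
  then only polynomially small, so \<open>L\<close> is logarithmic and negligible against
  \<open>Re \<mu>\<close>.\<close>

lemma spectral_moment_problem:
  fixes d :: "int \<times> bool \<Rightarrow> complex"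
  assumes e: "is_offset e" and T: "0 < T" and d: "\<And>p. cmod (d p) \<le> C * wt (fst p) ^ 6"
  shows "\<exists>g. cont_supp T g \<and> (\<forall>p. moment (eigval e p) g = d p)"
proof -
  obtain \<phi> :: "nat \<Rightarrow> int \<times> bool" where bij: "bij \<phi>"
    and base0: "summable (\<lambda>n. 1 / sqrt (wt (fst (\<phi> n))) ^ 3)" by (rule wt_enumeration)
  define s where "s p = sqrt (wt (fst p))" for p :: "int \<times> bool"
  have s1: "1 \<le> s p" and wts: "wt (fst p) = s p ^ 2" for p
    using wt_ge_1[of "fst p"] by (auto simp: s_def)
  have s0: "0 < s p" for p using s1[of p] by linarith
  have spow: "s p ^ i \<le> s p ^ j" if "i \<le> j" for p i j using s1 that by (intro power_increasing)
  have base: "summable (\<lambda>n. 1 / s (\<phi> n) ^ 3)" using base0 by (simp add: s_def)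
  define S where "S = (\<Sum>n. 1 / s (\<phi> n) ^ 3)"
  have S0: "0 \<le> S" unfolding S_def by (rule suminf_nonneg[OF base]) (simp add: less_imp_le[OF s0])
  \<comment> \<open>The bound \<open>1/2\<close> keeps the phases of conjugate pairs below 1; the
    other one makes the total delay at most \<open>T / 2\<close>.\<close>
  define \<eta> where "\<eta> = min (1/2) (T / (2 * (S + 1)))"
  have \<eta>: "0 < \<eta>" "\<eta> \<le> 1/2" "\<eta> * S \<le> T / 2"
  proof -
    show "0 < \<eta>" using T S0 by (auto simp: \<eta>_def)
    show "\<eta> \<le> 1/2" unfolding \<eta>_def by (rule min.cobounded1)
    have "\<eta> * S \<le> T / (2 * (S + 1)) * S" using S0 by (intro mult_right_mono) (auto simp: \<eta>_def)
    also have "\<dots> \<le> T / 2" using T S0 by (simp add: field_simps)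
    finally show "\<eta> * S \<le> T / 2" .
  qed
  \<comment> \<open>The imaginary parts are at most \<open>s^6\<close> in the quartic and
    \<open>s^2\<close> in the quadratic branch, so \<open>|Im| * \<delta> \<le> \<eta>\<close> in
    both.\<close>
  define \<delta> where "\<delta> p = \<eta> / s p ^ (if snd p then 6 else 3)" for p
  \<comment> \<open>Chosen so that \<open>exp (- L p) \<le> \<delta> p / 40\<close>, which lies
    below every factor: real separation gives \<open>\<delta> p / 20\<close> and a conjugate pair
    gives \<open>3/5 * \<delta> p\<close>.\<close>
  define L where "L p = ln (40 / \<eta>) + 6 * ln (s p)" for p
  have Re0: "0 \<le> Re (eigval e p)" for p using eigval_Re_nonneg(1)[OF e, of "fst p" "snd p"] by simp
  have Re4: "s p ^ 4 / 10 - 2 \<le> Re (eigval e p)" for p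
    using eigval_Re_nonneg(2)[OF e, of "fst p" "snd p"] by (simp add: wts flip: power_mult)
  have Re8: "s p ^ 8 / 10 - 2 \<le> Re (eigval e p)" if "snd p" for p
  proof -
    have "eigval e (fst p, True) = eigval e p" by (rule arg_cong[of _ _ "eigval e"]) (use that in \<open>cases p, simp\<close>)
    then show ?thesis using eigval_Re_nonneg(3)[OF e, of "fst p"] by (simp add: wts del: eigval_simps flip: power_mult)
  qed
  have \<delta>pos: "0 < \<delta> p" and \<delta>le: "\<delta> p \<le> \<eta> * (1 / s p ^ 3)" and \<delta>ge: "\<eta> / s p ^ 6 \<le> \<delta> p" for p
    using \<eta> s0[of p] spow[of 3 6 p] by (auto simp: \<delta>_def intro!: divide_left_mono)
  have \<delta>1: "\<delta> p \<le> 1" for p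
  proof -
    have "1 / s p ^ 3 \<le> 1" using s1[of p] by simp
    then have "\<eta> * (1 / s p ^ 3) \<le> \<eta> * 1" using \<eta> by (intro mult_left_mono) auto
    then show ?thesis using \<delta>le[of p] \<eta> by linarith
  qed
  have Lexp: "exp (- L p) \<le> \<delta> p / 40" for p
  proof -
    have "exp (6 * ln (s p)) = s p ^ 6" using exp_of_nat_mult[of 6 "ln (s p)"] s0[of p] by simp
    then have "exp (L p) = 40 / \<eta> * s p ^ 6" using \<eta> by (simp add: L_def exp_add)
    then have "exp (- L p) = (\<eta> / s p ^ 6) / 40" by (simp add: exp_minus field_simps)
    then show ?thesis using \<delta>ge[of p] by (simp add: divide_right_mono)
  qed
  have L0: "0 \<le> L p" for p using \<eta> s1[of p] by (simp add: L_def)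
  \<comment> \<open>The leading terms are \<open>s^4 / s^3\<close> in the quadratic and
    \<open>s^8 / s^6\<close> in the quartic branch; the constant 2 in \<open>Re4\<close> and
    \<open>Re8\<close> costs at most \<eta>.\<close>
  have damp: "\<eta> * s p / 20 - \<eta> \<le> Re (eigval e p) * \<delta> p / 2" for p
  proof -
    have "\<eta> / s p ^ j \<le> \<eta>" for j using \<eta> s1[of p] by (simp add: field_simps)
    note * = this[of 3] this[of 6]
    show ?thesis
    proof (cases "snd p")
      case True
      have "s p \<le> s p ^ 2" using spow[of 1 2 p] by simp
      then have "\<eta> * s p / 20 \<le> \<eta> * s p ^ 2 / 20" using \<eta> by simp
      moreover have "(s p ^ 8 / 10 - 2) * \<delta> p / 2 = \<eta> * s p ^ 2 / 20 - \<eta> / s p ^ 6"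
        using True s0[of p] by (simp add: \<delta>_def field_simps flip: power_add)
      moreover have "(s p ^ 8 / 10 - 2) * \<delta> p / 2 \<le> Re (eigval e p) * \<delta> p / 2"
        using Re8[OF True] \<delta>pos[of p] by simp
      ultimately show ?thesis using * by linarith
    next
      case False
      have "(s p ^ 4 / 10 - 2) * \<delta> p / 2 = \<eta> * s p / 20 - \<eta> / s p ^ 3"
        using False s0[of p] by (simp add: \<delta>_def field_simps power3_eq_cube power4_eq_xxxx)
      moreover have "(s p ^ 4 / 10 - 2) * \<delta> p / 2 \<le> Re (eigval e p) * \<delta> p / 2"
        using Re4[of p] \<delta>pos[of p] by simp
      ultimately show ?thesis using * by linarith
    qed
  qed
  have cmp: "summable (\<lambda>n. f (\<phi> n))" if "\<And>p. \<bar>f p\<bar> \<le> A * (1 / s p ^ 3)" for f and A :: real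
    by (rule summable_comparison_test'[OF summable_mult[OF base, of A]]) (use that in auto)
  have gap: "exp (- L p) \<le> cmod (1 - exp ((eigval e p' - eigval e p) * of_real (\<delta> p)))" if ne: "p \<noteq> p'" for p p'
  proof -
    obtain k b where p: "p = (k, b)" by fastforce
    obtain m c where p': "p' = (m, c)" by fastforce
    define z where "z = (eigval e p' - eigval e p) * of_real (\<delta> p)"
    \<comment> \<open>Conjugate pairs are told apart by their imaginary parts, all other pairs by
      their real parts.\<close>
    have "\<delta> p / 40 \<le> cmod (1 - exp z)"
    proof (cases "m = - k \<and> b = c")
      case True
      then have k: "k \<noteq> 0" using ne p p' by auto
      have z: "z = (cnj (eigval e p) - eigval e p) * of_real (\<delta> p)"
        unfolding z_def p p' using True eigval_conj[OF e k, of b] by simp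
      have Imz: "\<bar>Im z\<bar> = 2 * (\<bar>Im (eigval e p)\<bar> * \<delta> p)" using \<delta>pos[of p] by (simp add: z abs_mult)
      have "\<bar>Im (eigval e p)\<bar> * \<delta> p \<le> wt k ^ (if b then 3 else 1) * \<delta> p"
        using eigval_Im(2)[OF e k, of b] \<delta>pos[of p] unfolding p by (intro mult_right_mono) auto
      also have "\<dots> \<le> \<eta>"
      proof (cases b)
        case True
        then show ?thesis using wts[of p] s0[of p] by (simp add: \<delta>_def p flip: power_mult)
      next
        case False
        have "s p ^ 2 * \<eta> \<le> s p ^ 3 * \<eta>" using \<eta> spow[of 2 3 p] by (intro mult_right_mono) auto
        then show ?thesis using False wts[of p] s0[of p] by (simp add: \<delta>_def p field_simps)
      qed
      finally have "\<bar>Im z\<bar> \<le> 1" using \<eta> Imz by linarith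
      then have "\<bar>Im z\<bar> / 2 \<le> cmod (1 - exp z)" by (intro norm_one_minus_exp_Im) (auto simp: z)
      moreover have "3/5 * \<delta> p \<le> \<bar>Im (eigval e p)\<bar> * \<delta> p"
        using eigval_Im(1)[OF e k, of b] \<delta>pos[of p] unfolding p by (intro mult_right_mono) auto
      ultimately show ?thesis using Imz \<delta>pos[of p] by linarith
    next
      case False
      have "1/10 \<le> \<bar>Re (eigval e p - eigval e p')\<bar>"
        using eigval_Re_sep[OF e _ False] ne unfolding p p' by blast
      then have "1/10 \<le> \<bar>Re (eigval e p' - eigval e p)\<bar>" by (simp add: abs_minus_commute)
      then have "1/10 * \<delta> p \<le> \<bar>Re (eigval e p' - eigval e p)\<bar> * \<delta> p"
        using \<delta>pos[of p] by (intro mult_right_mono) auto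
      then have "\<delta> p / 10 \<le> \<bar>Re z\<bar>" using \<delta>pos[of p] by (simp add: z_def abs_mult)
      then have "\<delta> p / 10 / 2 \<le> cmod (1 - exp z)"
        by (rule norm_one_minus_exp_Re) (use \<delta>pos[of p] \<delta>1[of p] in auto)
      then show ?thesis using \<delta>pos[of p] by linarith
    qed
    then show ?thesis using Lexp[of p] unfolding z_def by linarith
  qed
  interpret sp: separated_spectrum "\<lambda>n. eigval e (\<phi> n)" "\<lambda>n. \<delta> (\<phi> n)" "\<lambda>n. L (\<phi> n)" T
  proof
    show "0 < T" "0 \<le> Re (eigval e (\<phi> n))" "0 < \<delta> (\<phi> n)" "0 \<le> L (\<phi> n)" for n by (fact T Re0 \<delta>pos L0)+
    show sd: "summable (\<lambda>n. \<delta> (\<phi> n))"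
      by (rule cmp[of \<delta> \<eta>]) (use \<delta>pos \<delta>le in \<open>auto simp: abs_of_pos\<close>)
    have "(\<Sum>n. \<delta> (\<phi> n)) \<le> (\<Sum>n. \<eta> * (1 / s (\<phi> n) ^ 3))"
      by (rule suminf_le[OF _ sd summable_mult[OF base]]) (rule \<delta>le)
    also have "\<dots> = \<eta> * S" unfolding S_def by (rule suminf_mult[OF base])
    finally show "(\<Sum>n. \<delta> (\<phi> n)) \<le> T / 2" using \<eta>(3) by linarith
    show "summable (\<lambda>n. exp (- (Re (eigval e (\<phi> n)) * \<delta> (\<phi> n) / 2)))"
    proof (rule cmp[of "\<lambda>p. exp (- (Re (eigval e p) * \<delta> p / 2))" "exp \<eta> * (256 * 20 ^ 4 / \<eta> ^ 4)"])
      fix p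
      have y: "0 < \<eta> * s p / 20" using \<eta> s0[of p] by simp
      have "exp (- (Re (eigval e p) * \<delta> p / 2)) \<le> exp (\<eta> + - (\<eta> * s p / 20))" using damp[of p] by simp
      also have "\<dots> = exp \<eta> * exp (- (\<eta> * s p / 20))" by (rule exp_add)
      also have "\<dots> \<le> exp \<eta> * (256 / (\<eta> * s p / 20) ^ 4)"
        by (intro mult_left_mono exp_minus_le_quartic y) auto
      also have "\<dots> = exp \<eta> * (256 * 20 ^ 4 / \<eta> ^ 4) * (1 / s p ^ 4)"
        by (simp add: power_divide power_mult_distrib)
      also have "\<dots> \<le> exp \<eta> * (256 * 20 ^ 4 / \<eta> ^ 4) * (1 / s p ^ 3)"
        using \<eta> spow[of 3 4 p] s0[of p] by (intro mult_left_mono divide_left_mono) auto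
      finally show "\<bar>exp (- (Re (eigval e p) * \<delta> p / 2))\<bar> \<le> exp \<eta> * (256 * 20 ^ 4 / \<eta> ^ 4) * (1 / s p ^ 3)" by simp
    qed
    show "exp (- L (\<phi> n)) \<le> cmod (1 - exp ((eigval e (\<phi> m) - eigval e (\<phi> n)) * of_real (\<delta> (\<phi> n))))" if "n \<noteq> m" for n m
      by (rule gap) (use that bij in \<open>auto simp: bij_def inj_eq\<close>)
    show "summable (\<lambda>n. L (\<phi> n) / (1 + Re (eigval e (\<phi> n))))"
    proof (rule cmp[of "\<lambda>p. L p / (1 + Re (eigval e p))" "30 * (ln (40 / \<eta>) + 6)"])
      fix p
      have ln0: "0 \<le> ln (40 / \<eta>)" using \<eta> by simp
      \<comment> \<open>\<open>(Re + 2) / 3 \<le> 1 + Re\<close> because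
        \<open>Re \<ge> 0\<close>.\<close>
      have "s p ^ 4 / 30 \<le> 1 + Re (eigval e p)" using Re4[of p] Re0[of p] by linarith
      then have "L p / (1 + Re (eigval e p)) \<le> L p / (s p ^ 4 / 30)"
        using L0[of p] s0[of p] Re0[of p] by (intro divide_left_mono) (auto intro!: mult_pos_pos add_pos_nonneg)
      also have "\<dots> \<le> ((ln (40 / \<eta>) + 6) * s p) / (s p ^ 4 / 30)"
      proof (rule divide_right_mono)
        have "ln (40 / \<eta>) * 1 \<le> ln (40 / \<eta>) * s p" using ln0 s1[of p] by (intro mult_left_mono)
        moreover have "ln (s p) \<le> s p" using ln_le_minus_one[OF s0[of p]] by linarith
        ultimately show "L p \<le> (ln (40 / \<eta>) + 6) * s p" by (simp add: L_def algebra_simps)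
      qed (use s0[of p] in simp)
      also have "\<dots> = 30 * (ln (40 / \<eta>) + 6) * (1 / s p ^ 3)"
        using s0[of p] by (simp add: power3_eq_cube power4_eq_xxxx mult_ac)
      finally show "\<bar>L p / (1 + Re (eigval e p))\<bar> \<le> 30 * (ln (40 / \<eta>) + 6) * (1 / s p ^ 3)"
        using L0[of p] Re0[of p] by simp
    qed
  qed
  \<comment> \<open>The data grow at most like \<open>s^12\<close>, while the exponential of order
    \<open>s^4\<close> is bounded through its fourth power by a multiple of
    \<open>s^-16\<close>.\<close>
  have "summable (\<lambda>n. cmod (d (\<phi> n)) * exp (- (Re (eigval e (\<phi> n)) * T / 8)))"
  proof (rule cmp[of "\<lambda>p. cmod (d p) * exp (- (Re (eigval e p) * T / 8))" "\<bar>C\<bar> * exp (T / 4) * (256 * 80 ^ 4 / T ^ 4)"])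
    fix p
    have y: "0 < T * s p ^ 4 / 80" using T s0[of p] by simp
    have "cmod (d p) \<le> \<bar>C\<bar> * wt (fst p) ^ 6"
      using d[of p] wt_pos[of "fst p"] by (smt (verit) mult_right_mono zero_le_power)
    then have dC: "cmod (d p) \<le> \<bar>C\<bar> * s p ^ 12" by (simp add: wts flip: power_mult)
    have "(s p ^ 4 / 10 - 2) * T \<le> Re (eigval e p) * T" using Re4[of p] T by (intro mult_right_mono) auto
    then have "exp (- (Re (eigval e p) * T / 8)) \<le> exp (T / 4 + - (T * s p ^ 4 / 80))" by (simp add: algebra_simps)
    also have "\<dots> = exp (T / 4) * exp (- (T * s p ^ 4 / 80))" by (rule exp_add)
    also have "\<dots> \<le> exp (T / 4) * (256 / (T * s p ^ 4 / 80) ^ 4)"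
      by (intro mult_left_mono exp_minus_le_quartic y) auto
    finally have ex: "exp (- (Re (eigval e p) * T / 8)) \<le> exp (T / 4) * (256 / (T * s p ^ 4 / 80) ^ 4)" .
    have "cmod (d p) * exp (- (Re (eigval e p) * T / 8)) \<le> (\<bar>C\<bar> * s p ^ 12) * (exp (T / 4) * (256 / (T * s p ^ 4 / 80) ^ 4))"
      by (intro mult_mono dC ex) (use s0[of p] in auto)
    also have "\<dots> = \<bar>C\<bar> * exp (T / 4) * (256 * 80 ^ 4 / T ^ 4) * (s p ^ 12 / s p ^ 16)"
      by (simp add: power_divide power_mult_distrib flip: power_mult)
    also have "s p ^ 12 / s p ^ 16 = 1 / s p ^ 4"
      using s0[of p] by (simp add: field_simps flip: power_add)
    also have "\<bar>C\<bar> * exp (T / 4) * (256 * 80 ^ 4 / T ^ 4) * (1 / s p ^ 4) \<le> \<bar>C\<bar> * exp (T / 4) * (256 * 80 ^ 4 / T ^ 4) * (1 / s p ^ 3)"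
      using T spow[of 3 4 p] s0[of p] by (intro mult_left_mono divide_left_mono) auto
    finally show "\<bar>cmod (d p) * exp (- (Re (eigval e p) * T / 8))\<bar> \<le> \<bar>C\<bar> * exp (T / 4) * (256 * 80 ^ 4 / T ^ 4) * (1 / s p ^ 3)"
      by simp
  qed
  then obtain g where "cont_supp T g" "\<And>n. moment (eigval e (\<phi> n)) g = d (\<phi> n)"
    using sp.moment_problem[of "\<lambda>n. d (\<phi> n)"] by blast
  moreover have "\<exists>n. p = \<phi> n" for p using bij by (meson bij_pointE)
  ultimately show ?thesis by metis
qed

section \<open>Dynamics of a single mode\<close>

lemma set_integral_continuous:
  fixes q :: "real \<Rightarrow> complex"
  assumes "continuous_on {0..T} q" "t \<in> {0..T}"
  shows "(LINT s:{0..t}|lborel. q s) = integral {0..t} q"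
proof -
  have "continuous_on {0..t} q" using assms continuous_on_subset by fastforce
  then show ?thesis by (intro set_borel_integral_eq_integral(2) borel_integrable_atLeastAtMost')
qed

lemma set_integral_at_0:
  fixes q :: "real \<Rightarrow> complex"
  shows "(LINT s:{0}|lborel. q s) = 0"
  using set_integral_continuous[of 0 q 0] by simp

lemma integral_eq_of_derivative:
  fixes x q :: "real \<Rightarrow> complex"
  assumes "\<And>t. t \<in> {0..T} \<Longrightarrow> (x has_vector_derivative q t) (at t within {0..T})"
    and q: "continuous_on {0..T} q" and t: "t \<in> {0..T}"
  shows "x t = x 0 + (LINT s:{0..t}|lborel. q s)"
proof -
  have "(q has_integral (x t - x 0)) {0..t}"
  proof (rule fundamental_theorem_of_calculus)
    show "(x has_vector_derivative q s) (at s within {0..t})" if "s \<in> {0..t}" for s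
      by (rule has_vector_derivative_within_subset[OF assms(1)]) (use that t in auto)
  qed (use t in simp)
  then show ?thesis by (simp add: set_integral_continuous[OF q t] integral_unique)
qed

text \<open>A mild solution with continuous integrand is differentiable in time, so each mode can be
  treated as an ordinary differential equation.\<close>

lemma derivative_of_integral_eq:
  fixes x q :: "real \<Rightarrow> complex"
  assumes eq: "\<And>t. t \<in> {0..T} \<Longrightarrow> x t = x0 + (LINT s:{0..t}|lborel. q s)"
    and q: "continuous_on {0..T} q" and t: "t \<in> {0..T}"
  shows "(x has_vector_derivative q t) (at t within {0..T})"
proof (rule has_vector_derivative_transform[OF t])
  show "x s = x0 + integral {0..s} q" if "s \<in> {0..T}" for s
    using eq[OF that] set_integral_continuous[OF q that] by simp
  show "((\<lambda>s. x0 + integral {0..s} q) has_vector_derivative q t) (at t within {0..T})"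
    using has_vector_derivative_add[OF has_vector_derivative_const integral_has_vector_derivative[OF q t]] by simp
qed

lemma exp_has_vector_derivative:
  fixes m :: complex
  shows "((\<lambda>t. exp (m * of_real t)) has_vector_derivative m * exp (m * of_real t)) (at t within S)"
proof -
  have "((\<lambda>z. exp (m * z)) has_field_derivative m * exp (m * of_real t)) (at (of_real t))"
    by (auto intro!: derivative_eq_intros)
  then have "((\<lambda>t. exp (m * of_real t)) has_vector_derivative m * exp (m * of_real t)) (at t)"
    by (rule has_vector_derivative_real_field)
  then show ?thesis by (rule has_vector_derivative_at_within)
qed

text \<open>The integrating factor \<open>exp (m * t)\<close> expresses the final state through the
  moment of \<open>g\<close> at \<open>m\<close>; this is the link from control to moments.\<close>

lemma linear_ode_final:
  fixes w g :: "real \<Rightarrow> complex"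
  assumes T: "0 \<le> T" and g: "continuous_on {0..T} g"
    and w: "\<And>t. t \<in> {0..T} \<Longrightarrow> (w has_vector_derivative - m * w t + c * g t) (at t within {0..T})"
  shows "exp (m * of_real T) * w T = w 0 + c * (LINT s:{0..T}|lborel. exp (m * of_real s) * g s)"
proof -
  define x where "x t = exp (m * of_real t) * w t" for t
  have "(x has_vector_derivative c * (exp (m * of_real t) * g t)) (at t within {0..T})" if "t \<in> {0..T}" for t
    using has_vector_derivative_mult[OF exp_has_vector_derivative[of m t "{0..T}"] w[OF that]]
    unfolding x_def by (simp add: algebra_simps)
  moreover have "continuous_on {0..T} (\<lambda>t. c * (exp (m * of_real t) * g t))" by (intro continuous_intros g)
  ultimately have "x T = x 0 + (LINT s:{0..T}|lborel. c * (exp (m * of_real s) * g s))"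
    by (rule integral_eq_of_derivative) (use T in auto)
  then show ?thesis by (simp add: x_def)
qed

section \<open>Duhamel's formula for a scalar equation\<close>

definition duhamel :: "complex \<Rightarrow> complex \<Rightarrow> complex \<Rightarrow> (real \<Rightarrow> complex) \<Rightarrow> real \<Rightarrow> complex" where
  "duhamel m w0 c g t = exp (- m * of_real t) * (w0 + c * integral {0..t} (\<lambda>s. exp (m * of_real s) * g s))"

lemma duhamel_0 [simp]: "duhamel m w0 c g 0 = w0"
  by (simp add: duhamel_def)

lemma duhamel_derivative:
  assumes g: "continuous_on {0..T} g" and t: "t \<in> {0..T}"
  shows "(duhamel m w0 c g has_vector_derivative - m * duhamel m w0 c g t + c * g t) (at t within {0..T})"
proof -
  let ?J = "\<lambda>t. integral {0..t} (\<lambda>s. exp (m * of_real s) * g s)"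
  have J: "(?J has_vector_derivative exp (m * of_real t) * g t) (at t within {0..T})"
    by (rule integral_has_vector_derivative[OF _ t]) (intro continuous_intros g)
  have "((\<lambda>t. w0 + c * ?J t) has_vector_derivative 0 + c * (exp (m * of_real t) * g t)) (at t within {0..T})"
    by (intro has_vector_derivative_add has_vector_derivative_const has_vector_derivative_mult_right J)
  from has_vector_derivative_mult[OF exp_has_vector_derivative[of "- m" t "{0..T}"] this]
  show ?thesis unfolding duhamel_def[abs_def]
    by (simp add: algebra_simps exp_minus)
qed

text \<open>\<open>Re m \<ge> 0\<close> bounds the kernel \<open>exp (- m * (t - s))\<close> by 1,
  so the estimate is uniform over the spectrum.\<close>

lemma duhamel_norm:
  assumes g: "continuous_on {0..T} g" and t: "t \<in> {0..T}" and G: "\<And>s. cmod (g s) \<le> G" and m: "0 \<le> Re m"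
  shows "cmod (duhamel m w0 c g t) \<le> cmod w0 + cmod c * (T * G)"
proof -
  let ?J = "integral {0..t} (\<lambda>s. exp (m * of_real s) * g s)"
  have G0: "0 \<le> G" using G[of 0] norm_ge_zero order_trans by blast
  have gt: "continuous_on {0..t} g" using g t continuous_on_subset by fastforce
  have "cmod ?J \<le> exp (Re m * t) * G * (t - 0)"
  proof (rule integral_bound)
    show "0 \<le> t" using t by simp
    show "continuous_on {0..t} (\<lambda>s. exp (m * of_real s) * g s)" by (intro continuous_intros gt)
    show "cmod (exp (m * of_real s) * g s) \<le> exp (Re m * t) * G" if "s \<in> {0..t}" for s
      unfolding norm_mult using that m G by (intro mult_mono) (auto simp: norm_exp_eq_Re intro!: mult_left_mono)
  qed
  moreover have "exp (Re m * t) * G * (t - 0) \<le> exp (Re m * t) * (T * G)"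
    using mult_left_mono[OF mult_right_mono[of t T G], of "exp (Re m * t)"] t G0 by (simp add: mult_ac)
  ultimately have J: "cmod ?J \<le> exp (Re m * t) * (T * G)" by linarith
  have "cmod (duhamel m w0 c g t) = exp (- (Re m * t)) * cmod (w0 + c * ?J)"
    by (simp add: duhamel_def norm_mult norm_exp_eq_Re)
  also have "\<dots> \<le> exp (- (Re m * t)) * (cmod w0 + cmod c * (exp (Re m * t) * (T * G)))"
    using norm_triangle_ineq[of w0 "c * ?J"] mult_left_mono[OF J, of "cmod c"]
    by (intro mult_left_mono) (auto simp: norm_mult)
  also have "\<dots> = exp (- (Re m * t)) * cmod w0 + cmod c * (T * G)"
    by (simp add: distrib_left exp_minus)
  also have "\<dots> \<le> cmod w0 + cmod c * (T * G)"
    using m t mult_right_mono[of "exp (- (Re m * t))" 1 "cmod w0"] by simp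
  finally show ?thesis .
qed

text \<open>The row vector \<open>(I, m - a)\<close> is a left eigenvector of the mode matrix with entries \<open>a, I, I, b\<close>.\<close>

lemma mode_eigen_combination:
  fixes I a b m u v r :: complex
  assumes "(m - a) * (m - b) = I\<^sup>2"
  shows "I * (- a * u - I * v + r) + (m - a) * (- b * v - I * u) = - m * (I * u + (m - a) * v) + I * r"
proof -
  have "I * (- a * u - I * v + r) + (m - a) * (- b * v - I * u)
      = - m * I * u - I\<^sup>2 * v - (m - a) * b * v + I * r" by (simp add: algebra_simps power2_eq_square)
  also have "I\<^sup>2 = (m - a) * (m - b)" using assms by simp
  finally show ?thesis by (simp add: algebra_simps)
qed

text \<open>Pairing the mode with a left eigenvector leaves a scalar equation with rate
  \<open>m\<close>, and the moment condition makes the control cancel its initial value.\<close>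

lemma mode_final_zero:
  fixes u v g :: "real \<Rightarrow> complex"
  assumes T: "0 \<le> T" and g: "continuous_on {0..T} g"
    and u: "continuous_on {0..T} u" and v: "continuous_on {0..T} v"
    and equ: "\<And>t. t \<in> {0..T} \<Longrightarrow> u t = u0 + (LINT s:{0..t}|lborel. - a * u s - I * v s + F * g s)"
    and eqv: "\<And>t. t \<in> {0..T} \<Longrightarrow> v t = v0 + (LINT s:{0..t}|lborel. - b * v s - I * u s)"
    and m: "(m - a) * (m - b) = I\<^sup>2"
    and mom: "I * F * (LINT s:{0..T}|lborel. exp (m * of_real s) * g s) = - (I * u0 + (m - a) * v0)"
  shows "I * u T + (m - a) * v T = 0"
proof -
  define w where "w t = I * u t + (m - a) * v t" for t
  have du: "(u has_vector_derivative - a * u t - I * v t + F * g t) (at t within {0..T})" if "t \<in> {0..T}" for t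
    by (rule derivative_of_integral_eq[OF equ _ that]) (auto intro!: continuous_intros u v g)
  have dv: "(v has_vector_derivative - b * v t - I * u t) (at t within {0..T})" if "t \<in> {0..T}" for t
    by (rule derivative_of_integral_eq[OF eqv _ that]) (auto intro!: continuous_intros u v)
  have "(w has_vector_derivative - m * w t + (I * F) * g t) (at t within {0..T})" if "t \<in> {0..T}" for t
    using has_vector_derivative_add[OF has_vector_derivative_mult_right[OF du[OF that], of I] has_vector_derivative_mult_right[OF dv[OF that], of "m - a"]]
    unfolding w_def mode_eigen_combination[OF m] by (simp add: mult.assoc)
  from linear_ode_final[OF T g this] have "exp (m * of_real T) * w T = w 0 + I * F * (LINT s:{0..T}|lborel. exp (m * of_real s) * g s)"
    by simp
  moreover have "u 0 = u0" "v 0 = v0" using equ[of 0] eqv[of 0] T by (auto simp: set_integral_at_0)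
  ultimately have "exp (m * of_real T) * w T = 0" unfolding mom by (simp add: w_def)
  then show ?thesis by (simp add: w_def)
qed

text \<open>The scalar equations along the two left eigenvectors are solved by Duhamel's formula,
  and \<open>u\<close>, \<open>v\<close> are recovered by inverting a change of variables with
  determinant \<open>I * (m2 - m1)\<close>. Since \<open>|m1 - m2| \<ge> |I|^2\<close>, the factor
  \<open>I\<close> in front of \<open>u0\<close> turns into \<open>1 / |I|\<close> in the bound for
  \<open>v\<close>: the power that separates the dual of H^1 from the dual of H^2. All other
  constants are uniform in the mode.\<close>

lemma mode_exists:
  fixes g :: "real \<Rightarrow> complex"
  assumes g: "continuous_on {0..T} g" and G: "\<And>s. cmod (g s) \<le> G"
    and I: "1 \<le> cmod I" and m1: "(m1 - a) * (m1 - b) = I\<^sup>2" and m2: "(m2 - a) * (m2 - b) = I\<^sup>2"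
    and Re: "0 \<le> Re m1" "0 \<le> Re m2" and diff: "(cmod I)\<^sup>2 \<le> cmod (m1 - m2)" and off: "cmod (m1 - a) \<le> 1"
    and T: "0 \<le> T"
  shows "\<exists>u v. continuous_on {0..T} u \<and> continuous_on {0..T} v \<and>
    (\<forall>t\<in>{0..T}. u t = u0 + (LINT s:{0..t}|lborel. - a * u s - I * v s + F * g s) \<and>
       v t = v0 + (LINT s:{0..t}|lborel. - b * v s - I * u s) \<and>
       cmod (u t) \<le> 3 * cmod u0 + 4 * cmod v0 + 3 * (cmod F * (T * G)) \<and>
       cmod (v t) \<le> 2 / cmod I * cmod u0 + 3 * cmod v0 + 2 * (cmod F * (T * G)))"
proof -
  have "1 \<le> (cmod I)\<^sup>2" using I by simp
  then have P1: "1 \<le> cmod (m1 - m2)" using diff by linarith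
  then have ne: "m1 - m2 \<noteq> 0" "I \<noteq> 0" using I by auto
  define w where "w m = duhamel m (I * u0 + (m - a) * v0) (I * F) g" for m
  define v where "v t = (w m1 t - w m2 t) / (m1 - m2)" for t
  define u where "u t = (w m1 t - (m1 - a) * v t) / I" for t
  have w1: "w m1 t = I * u t + (m1 - a) * v t" for t using ne by (simp add: u_def)
  have w2: "w m2 t = I * u t + (m2 - a) * v t" for t
  proof -
    have "(m1 - m2) * v t = w m1 t - w m2 t" using ne by (simp add: v_def)
    then have "w m2 t = w m1 t - (m1 - m2) * v t" by simp
    then show ?thesis unfolding w1 by (simp add: algebra_simps)
  qed
  define dv where "dv t = - b * v t - I * u t" for t
  define du where "du t = - a * u t - I * v t + F * g t" for t
  have q1: "- m1 * w m1 t + I * F * g t = I * du t + (m1 - a) * dv t" for t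
    unfolding du_def dv_def w1 mode_eigen_combination[OF m1] by simp
  have q2: "- m2 * w m2 t + I * F * g t = I * du t + (m2 - a) * dv t" for t
    unfolding du_def dv_def w2 mode_eigen_combination[OF m2] by simp
  have W: "(w m has_vector_derivative - m * w m t + I * F * g t) (at t within {0..T})" if "t \<in> {0..T}" for m t
    using duhamel_derivative[OF g that, of m "I * u0 + (m - a) * v0" "I * F"] by (simp only: w_def)
  have Dv: "(v has_vector_derivative dv t) (at t within {0..T})" if t: "t \<in> {0..T}" for t
  proof -
    have "((\<lambda>t. (w m1 t - w m2 t) / (m1 - m2)) has_vector_derivative
        (I * du t + (m1 - a) * dv t - (I * du t + (m2 - a) * dv t)) / (m1 - m2)) (at t within {0..T})"
      using W[OF t, of m1] W[OF t, of m2] unfolding q1 q2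
      by (intro has_vector_derivative_divide has_vector_derivative_diff)
    moreover have "(I * du t + (m1 - a) * dv t - (I * du t + (m2 - a) * dv t)) / (m1 - m2) = dv t"
      using ne by (simp add: field_simps)
    ultimately show ?thesis by (simp add: v_def[abs_def])
  qed
  have Du: "(u has_vector_derivative du t) (at t within {0..T})" if t: "t \<in> {0..T}" for t
  proof -
    have "((\<lambda>t. (w m1 t - (m1 - a) * v t) / I) has_vector_derivative
        (I * du t + (m1 - a) * dv t - (m1 - a) * dv t) / I) (at t within {0..T})"
      using W[OF t, of m1] Dv[OF t] unfolding q1
      by (intro has_vector_derivative_divide has_vector_derivative_diff has_vector_derivative_mult_right)
    then show ?thesis using ne by (simp add: u_def[abs_def])
  qed
  have cu: "continuous_on {0..T} u" and cv: "continuous_on {0..T} v"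
    unfolding continuous_on_eq_continuous_within using Du Dv has_vector_derivative_continuous by blast+
  have v0: "v 0 = v0" using ne by (simp add: v_def w_def field_simps)
  have u0: "u 0 = u0" using ne unfolding u_def v0 by (simp add: w_def)
  define B where "B = cmod F * (T * G)"
  have B0: "0 \<le> B" using G[of 0] T norm_ge_zero order_trans[of 0 "cmod (g 0)" G] by (simp add: B_def)
  define n P where "n = cmod I" and "P = cmod (m1 - m2)"
  have n: "1 \<le> n" "n\<^sup>2 \<le> P" "1 \<le> P" using I diff P1 by (auto simp: n_def P_def)
  have bounds: "cmod (v t) \<le> 2 / n * cmod u0 + 3 * cmod v0 + 2 * B" "cmod (u t) \<le> 3 * cmod u0 + 4 * cmod v0 + 3 * B"
    if t: "t \<in> {0..T}" for t
  proof -
    have wb: "cmod (w m t) \<le> n * cmod u0 + cmod (m - a) * cmod v0 + n * B" if "0 \<le> Re m" for m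
      using duhamel_norm[OF g t G that, of "I * u0 + (m - a) * v0" "I * F"]
        norm_triangle_ineq[of "I * u0" "(m - a) * v0"]
      unfolding w_def norm_mult n_def B_def by (simp add: mult_ac)
    \<comment> \<open>\<open>m2 - a\<close> may be large, but not beyond \<open>1 + P\<close>, and
      \<open>v\<close> is divided by \<open>P\<close>.\<close>
    have "m2 - a = (m1 - a) - (m1 - m2)" by simp
    then have "cmod (m2 - a) \<le> cmod (m1 - a) + P"
      unfolding P_def by (metis norm_triangle_ineq4)
    then have m2a: "cmod (m2 - a) \<le> 1 + P" using off by linarith
    have "cmod (m1 - a) * cmod v0 \<le> 1 * cmod v0" "cmod (m2 - a) * cmod v0 \<le> (1 + P) * cmod v0"
      using off m2a by (intro mult_right_mono; simp)+
    then have w1b: "cmod (w m1 t) \<le> n * cmod u0 + cmod v0 + n * B"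
      and w2b: "cmod (w m2 t) \<le> n * cmod u0 + (1 + P) * cmod v0 + n * B"
      using wb[OF Re(1)] wb[OF Re(2)] by linarith+
    have "cmod (v t) = cmod (w m1 t - w m2 t) / P" by (simp add: v_def P_def norm_divide)
    also have "\<dots> \<le> (2 * n * cmod u0 + (2 + P) * cmod v0 + 2 * n * B) / P"
      using w1b w2b norm_triangle_ineq4[of "w m1 t" "w m2 t"] n
      by (intro divide_right_mono) (auto simp: algebra_simps)
    also have "\<dots> = (n / P) * (2 * cmod u0) + ((2 + P) / P) * cmod v0 + (n / P) * (2 * B)"
      using n by (simp add: field_simps)
    also have "\<dots> \<le> (1 / n) * (2 * cmod u0) + 3 * cmod v0 + 1 * (2 * B)"
    proof (intro add_mono mult_right_mono)
      show nP: "n / P \<le> 1 / n" using n by (simp add: field_simps power2_eq_square)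
      have "1 / n \<le> 1" using n by simp
      then show "n / P \<le> 1" using nP by linarith
      show "(2 + P) / P \<le> 3" using n by (simp add: field_simps)
    qed (use B0 in auto)
    finally show vb: "cmod (v t) \<le> 2 / n * cmod u0 + 3 * cmod v0 + 2 * B" by simp
    have "2 / n * cmod u0 \<le> 2 * cmod u0" using n by (intro mult_right_mono) (auto simp: field_simps)
    then have vb': "cmod (v t) \<le> 2 * cmod u0 + 3 * cmod v0 + 2 * B" using vb by linarith
    have "cmod ((m1 - a) * v t) \<le> cmod (v t)"
      unfolding norm_mult using off by (simp add: mult_left_le_one_le)
    then have "cmod (w m1 t - (m1 - a) * v t) \<le> n * cmod u0 + cmod v0 + n * B + (2 * cmod u0 + 3 * cmod v0 + 2 * B)"
      using w1b vb' norm_triangle_ineq4[of "w m1 t" "(m1 - a) * v t"] by linarith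
    also have "\<dots> \<le> n * (3 * cmod u0 + 4 * cmod v0 + 3 * B)"
    proof -
      have "1 * cmod u0 \<le> n * cmod u0" "1 * cmod v0 \<le> n * cmod v0" "1 * B \<le> n * B"
        using n B0 by (intro mult_right_mono; simp)+
      then show ?thesis by (simp add: algebra_simps)
    qed
    finally have "cmod (w m1 t - (m1 - a) * v t) / n \<le> 3 * cmod u0 + 4 * cmod v0 + 3 * B"
      using n by (simp add: pos_divide_le_eq mult.commute)
    then show "cmod (u t) \<le> 3 * cmod u0 + 4 * cmod v0 + 3 * B" by (simp add: u_def n_def norm_divide)
  qed
  have cdu: "continuous_on {0..T} du" and cdv: "continuous_on {0..T} dv"
    unfolding du_def[abs_def] dv_def[abs_def] by (intro continuous_intros cu cv g)+
  have "u t = u0 + (LINT s:{0..t}|lborel. du s)" "v t = v0 + (LINT s:{0..t}|lborel. dv s)" if "t \<in> {0..T}" for t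
    using integral_eq_of_derivative[OF Du cdu that] integral_eq_of_derivative[OF Dv cdv that] u0 v0 by auto
  then show ?thesis using cu cv bounds unfolding du_def dv_def n_def B_def
    by (intro exI[of _ u] exI[of _ v] conjI ballI) simp_all
qed

section \<open>Dual spaces and the control profile\<close>

lemma norm_diff_square_le: "(cmod (x - y))\<^sup>2 \<le> 2 * (cmod x)\<^sup>2 + 2 * (cmod y)\<^sup>2"
proof -
  have "(cmod (x - y))\<^sup>2 \<le> (cmod x + cmod y)\<^sup>2" by (intro power_mono norm_triangle_ineq4) simp
  also have "\<dots> \<le> 2 * (cmod x)\<^sup>2 + 2 * (cmod y)\<^sup>2"
    using zero_le_power2[of "cmod x - cmod y"] by (simp add: power2_eq_square algebra_simps)
  finally show ?thesis .
qed

lemma dual_space_diff: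
  assumes "dual_space s c" "dual_space s c'"
  shows "dual_space s (\<lambda>k. c k - c' k)"
proof -
  let ?W = "\<lambda>k::int. (1 + (real_of_int k)\<^sup>2) powr s"
  have "(\<lambda>k. 2 * ((cmod (c k))\<^sup>2 / ?W k) + 2 * ((cmod (c' k))\<^sup>2 / ?W k)) summable_on UNIV"
    using assms unfolding dual_space_def by (intro summable_on_add summable_on_cmult_right)
  then show ?thesis unfolding dual_space_def
  proof (rule summable_on_comparison_test)
    fix k
    show "(cmod (c k - c' k))\<^sup>2 / ?W k \<le> 2 * ((cmod (c k))\<^sup>2 / ?W k) + 2 * ((cmod (c' k))\<^sup>2 / ?W k)"
      using divide_right_mono[OF norm_diff_square_le[of "c k" "c' k"], of "?W k"] by (simp add: add_divide_distrib)
  qed auto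
qed

text \<open>One term of the series defining the norm; hence the data grow at most polynomially in
  \<open>k\<close>.\<close>

lemma dual_norm_coeff:
  assumes "dual_space s c"
  shows "cmod (c k) \<le> dual_norm s c * (1 + (real_of_int k)\<^sup>2) powr (s / 2)"
proof -
  let ?W = "\<lambda>k::int. (1 + (real_of_int k)\<^sup>2) powr s"
  have "(\<Sum>k\<in>{k}. (cmod (c k))\<^sup>2 / ?W k) \<le> (\<Sum>\<^sub>\<infinity>k. (cmod (c k))\<^sup>2 / ?W k)"
    using assms unfolding dual_space_def by (intro finite_sum_le_infsum) auto
  then have "sqrt ((cmod (c k))\<^sup>2 / ?W k) \<le> dual_norm s c"
    unfolding dual_norm_def by simp
  then have "cmod (c k) / sqrt (?W k) \<le> dual_norm s c" by (simp add: real_sqrt_divide)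
  moreover have "0 < 1 + (real_of_int k)\<^sup>2" by (simp add: add_pos_nonneg)
  then have "sqrt (?W k) = (1 + (real_of_int k)\<^sup>2) powr (s / 2)" "0 < (1 + (real_of_int k)\<^sup>2) powr (s / 2)"
    by (simp_all add: powr_powr flip: powr_half_sqrt)
  ultimately show ?thesis by (simp add: pos_divide_le_eq)
qed

lemma cont_dual_imp_continuous_on:
  assumes "cont_dual s T w"
  shows "continuous_on {0..T} (\<lambda>t. w t k)"
  unfolding continuous_on_iff
proof (intro ballI allI impI)
  fix t \<epsilon> :: real assume t: "t \<in> {0..T}" and \<epsilon>: "0 < \<epsilon>"
  let ?W = "(1 + (real_of_int k)\<^sup>2) powr (s / 2)"
  have W: "0 < ?W" using add_pos_nonneg[of 1 "(real_of_int k)\<^sup>2"] by simp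
  then have "0 < \<epsilon> / ?W" using \<epsilon> by simp
  then obtain \<delta> where \<delta>: "\<delta> > 0" "\<And>t'. t' \<in> {0..T} \<Longrightarrow> \<bar>t' - t\<bar> < \<delta> \<Longrightarrow> dual_norm s (\<lambda>k. w t' k - w t k) < \<epsilon> / ?W"
    using assms t unfolding cont_dual_def by meson
  have "dist (w t' k) (w t k) < \<epsilon>" if t': "t' \<in> {0..T}" "dist t' t < \<delta>" for t'
  proof -
    have "dual_space s (\<lambda>k. w t' k - w t k)"
      using assms t t'(1) unfolding cont_dual_def by (intro dual_space_diff) auto
    from dual_norm_coeff[OF this, of k] have "dist (w t' k) (w t k) \<le> dual_norm s (\<lambda>k. w t' k - w t k) * ?W"
      by (simp add: dist_norm)
    also have "\<dots> < \<epsilon> / ?W * ?W"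
      using \<delta>(2)[OF t'(1)] t'(2) W by (intro mult_strict_right_mono) (auto simp: dist_real_def)
    finally show ?thesis using W by simp
  qed
  then show "\<exists>d>0. \<forall>t'\<in>{0..T}. dist t' t < d \<longrightarrow> dist (w t' k) (w t k) < \<epsilon>"
    using \<delta>(1) by blast
qed

text \<open>A majorant independent of time makes the series of the squared norm of
  \<open>w t' - w t\<close> converge uniformly in \<open>t'\<close>, so continuity of the
  coefficients passes to the norm.\<close>

lemma cont_dual_dominated:
  fixes M :: "int \<Rightarrow> real"
  assumes M: "M summable_on UNIV"
    and bd: "\<And>t k. t \<in> {0..T} \<Longrightarrow> (cmod (w t k))\<^sup>2 / (1 + (real_of_int k)\<^sup>2) powr s \<le> M k"
    and c: "\<And>k. continuous_on {0..T} (\<lambda>t. w t k)"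
  shows "cont_dual s T w"
  unfolding cont_dual_def
proof (intro conjI ballI allI impI)
  show "dual_space s (w t)" if "t \<in> {0..T}" for t
    unfolding dual_space_def by (rule summable_on_comparison_test[OF M]) (use bd that in auto)
next
  fix t \<epsilon> :: real assume t: "t \<in> {0..T}" and \<epsilon>: "0 < \<epsilon>"
  let ?W = "\<lambda>k::int. (1 + (real_of_int k)\<^sup>2) powr s"
  let ?D = "\<lambda>k t'. (cmod (w t' k - w t k))\<^sup>2 / ?W k"
  have "uniform_limit {0..T} (\<lambda>X t'. \<Sum>k\<in>X. ?D k t') (\<lambda>t'. \<Sum>\<^sub>\<infinity>k. ?D k t') (finite_subsets_at_top UNIV)"
  proof (rule Weierstrass_m_test_general)
    show "norm (?D k t') \<le> 4 * M k" if "t' \<in> {0..T}" for k t'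
    proof -
      have "?D k t' \<le> (2 * (cmod (w t' k))\<^sup>2 + 2 * (cmod (w t k))\<^sup>2) / ?W k"
        by (intro divide_right_mono norm_diff_square_le) simp
      also have "\<dots> = 2 * ((cmod (w t' k))\<^sup>2 / ?W k) + 2 * ((cmod (w t k))\<^sup>2 / ?W k)"
        by (simp add: add_divide_distrib)
      finally show ?thesis using bd[OF t, of k] bd[OF that, of k] by simp
    qed
    show "(\<lambda>k. 4 * M k) summable_on UNIV" by (rule summable_on_cmult_right[OF M])
  qed
  then have "continuous_on {0..T} (\<lambda>t'. \<Sum>\<^sub>\<infinity>k. ?D k t')"
    by (rule uniform_limit_theorem[rotated]) (auto intro!: always_eventually continuous_intros c add_pos_nonneg simp: less_imp_neq[THEN not_sym] add_nonneg_eq_0_iff)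
  then have "continuous_on {0..T} (\<lambda>t'. dual_norm s (\<lambda>k. w t' k - w t k))"
    unfolding dual_norm_def by (intro continuous_intros)
  then obtain \<delta> where \<delta>: "\<delta> > 0" "\<And>t'. t' \<in> {0..T} \<Longrightarrow> dist t' t < \<delta> \<Longrightarrow>
      dist (dual_norm s (\<lambda>k. w t' k - w t k)) (dual_norm s (\<lambda>k. w t k - w t k)) < \<epsilon>"
    using t \<epsilon> unfolding continuous_on_iff by meson
  moreover have "dual_norm s (\<lambda>k. w t k - w t k) = 0" by (simp add: dual_norm_def)
  ultimately show "\<exists>\<delta>>0. \<forall>t'\<in>{0..T}. \<bar>t' - t\<bar> < \<delta> \<longrightarrow> dual_norm s (\<lambda>k. w t' k - w t k) < \<epsilon>"
    by (intro exI[of _ \<delta>]) (auto simp: dist_real_def abs_less_iff)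
qed

lemma moment_eq_set_integral:
  assumes "cont_supp T g"
  shows "moment z g = (LINT s:{0..T}|lborel. exp (z * of_real s) * g s)"
  unfolding moment_def set_lebesgue_integral_def
  using assms by (intro Bochner_Integration.integral_cong) (auto simp: cont_supp_def indicator_def)

lemma cont_supp_bounded:
  assumes "cont_supp T g"
  obtains G where "0 \<le> G" "\<And>s. cmod (g s) \<le> G"
proof -
  have "continuous_on {0..T} g" using assms continuous_on_subset unfolding cont_supp_def by blast
  then have "bounded (g ` {0..T})" by (intro compact_imp_bounded compact_continuous_image) auto
  then obtain G where "G > 0" "\<And>s. s \<in> {0..T} \<Longrightarrow> cmod (g s) \<le> G" by (auto simp: bounded_pos)
  then have "cmod (g s) \<le> G" for s using assms by (cases "s \<in> {0..T}") (auto simp: cont_supp_def)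
  with \<open>G > 0\<close> that[of G] show ?thesis by simp
qed

section \<open>Fourier coefficients of the control profile\<close>

lemma fcoef_mult_right: "fcoef (\<lambda>x. \<phi> x * c) k = fcoef \<phi> k * c"
proof -
  have "(LINT x:{0..2*pi}|lborel. \<phi> x * c * exp (\<i> * of_int k * of_real x))
      = (LINT x:{0..2*pi}|lborel. \<phi> x * exp (\<i> * of_int k * of_real x) * c)"
    by (simp add: mult_ac)
  then show ?thesis by (simp add: fcoef_def)
qed

lemma fcoef_exp_window:
  assumes "0 \<le> \<alpha>" "\<alpha> < \<beta>" "\<beta> \<le> 2 * pi"
  shows "fcoef (\<lambda>x. indicator {\<alpha>..\<beta>} x * exp (of_real x)) k
     = (exp ((1 + \<i> * of_int k) * of_real \<beta>) - exp ((1 + \<i> * of_int k) * of_real \<alpha>)) / (2 * pi * (1 + \<i> * of_int k))"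
proof -
  define z where "z = 1 + \<i> * of_int k"
  have "Re z = 1" by (simp add: z_def)
  then have z: "z \<noteq> 0" by auto
  have "(LINT x:{0..2*pi}|lborel. indicator {\<alpha>..\<beta>} x * exp (of_real x) * exp (\<i> * of_int k * of_real x))
      = (LINT x:{\<alpha>..\<beta>}|lborel. exp (z * of_real x))"
    unfolding set_lebesgue_integral_def using assms
    by (intro Bochner_Integration.integral_cong)
       (auto simp: indicator_def z_def distrib_right exp_add)
  also have "\<dots> = integral {\<alpha>..\<beta>} (\<lambda>x. exp (z * of_real x))"
    by (intro set_borel_integral_eq_integral(2) borel_integrable_atLeastAtMost' continuous_intros)
  also have "\<dots> = exp (z * of_real \<beta>) / z - exp (z * of_real \<alpha>) / z"
  proof (rule integral_unique, rule fundamental_theorem_of_calculus)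
    show "((\<lambda>x. exp (z * of_real x) / z) has_vector_derivative exp (z * of_real x)) (at x within {\<alpha>..\<beta>})" for x
      using has_vector_derivative_divide[OF exp_has_vector_derivative[of z x "{\<alpha>..\<beta>}"], of z] z by simp
  qed (use assms in simp)
  finally show ?thesis unfolding fcoef_def z_def[symmetric] by (simp add: diff_divide_distrib mult_ac)
qed

text \<open>The endpoint exponentials have the different moduli \<open>exp \<beta>\<close> and
  \<open>exp \<alpha>\<close>, so they cannot cancel at any frequency, as they could for a plain
  indicator function. The loss \<open>1 / wt k\<close> comes from the denominator
  \<open>1 + \<i> * k\<close>.\<close>

lemma fcoef_exp_window_bounds:
  assumes "0 \<le> \<alpha>" "\<alpha> < \<beta>" "\<beta> \<le> 2 * pi"
  shows "(exp \<beta> - exp \<alpha>) / (2 * pi) / wt k \<le> cmod (fcoef (\<lambda>x. indicator {\<alpha>..\<beta>} x * exp (of_real x)) k)"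
    and "cmod (fcoef (\<lambda>x. indicator {\<alpha>..\<beta>} x * exp (of_real x)) k) \<le> exp \<beta> + exp \<alpha>"
proof -
  define z where "z = 1 + \<i> * of_int k"
  have rez: "Re z = 1" by (simp add: z_def)
  have z1: "1 \<le> cmod z" using complex_Re_le_cmod[of z] rez by simp
  have zw: "cmod z \<le> wt k" using norm_triangle_ineq[of 1 "\<i> * of_int k"] by (simp add: z_def wt_def norm_mult)
  have eq: "cmod (fcoef (\<lambda>x. indicator {\<alpha>..\<beta>} x * exp (of_real x)) k)
      = cmod (exp (z * of_real \<beta>) - exp (z * of_real \<alpha>)) / (2 * pi * cmod z)"
    unfolding fcoef_exp_window[OF assms] z_def[symmetric] by (simp add: norm_divide norm_mult)
  have "exp \<beta> - exp \<alpha> \<le> cmod (exp (z * of_real \<beta>) - exp (z * of_real \<alpha>))"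
    using norm_triangle_ineq2[of "exp (z * of_real \<beta>)" "exp (z * of_real \<alpha>)"] by (simp add: rez)
  then have "(exp \<beta> - exp \<alpha>) / (2 * pi * wt k) \<le> cmod (exp (z * of_real \<beta>) - exp (z * of_real \<alpha>)) / (2 * pi * cmod z)"
    using assms z1 zw by (intro frac_le mult_pos_pos mult_left_mono) (auto simp del: mult_pos_pos)
  then show "(exp \<beta> - exp \<alpha>) / (2 * pi) / wt k \<le> cmod (fcoef (\<lambda>x. indicator {\<alpha>..\<beta>} x * exp (of_real x)) k)"
    unfolding eq by simp
  have "cmod (exp (z * of_real \<beta>) - exp (z * of_real \<alpha>)) \<le> exp \<beta> + exp \<alpha>"
    using norm_triangle_ineq4[of "exp (z * of_real \<beta>)" "exp (z * of_real \<alpha>)"] by (simp add: rez)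
  moreover have "1 \<le> 2 * pi * cmod z"
    using mult_mono[of 1 "2 * pi" 1 "cmod z"] z1 pi_gt3 by simp
  ultimately have "cmod (exp (z * of_real \<beta>) - exp (z * of_real \<alpha>)) / (2 * pi * cmod z) \<le> (exp \<beta> + exp \<alpha>) / 1"
    by (intro frac_le) auto
  then show "cmod (fcoef (\<lambda>x. indicator {\<alpha>..\<beta>} x * exp (of_real x)) k) \<le> exp \<beta> + exp \<alpha>"
    unfolding eq by simp
qed

lemma L2_rect_separated:
  fixes \<phi> g :: "real \<Rightarrow> complex"
  assumes [measurable]: "\<phi> \<in> borel_measurable borel" "g \<in> borel_measurable borel"
    and \<phi>: "\<And>x. x \<in> {0<..<2*pi} \<Longrightarrow> cmod (\<phi> x) \<le> A" and g: "\<And>t. cmod (g t) \<le> G"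
  shows "L2_rect T (\<lambda>t x. \<phi> x * g t)"
proof -
  have "(\<lambda>p. \<phi> (snd p) * g (fst p)) \<in> borel_measurable (borel \<Otimes>\<^sub>M borel)" by measurable
  then have m [measurable]: "(\<lambda>p. \<phi> (snd p) * g (fst p)) \<in> borel_measurable borel" by (simp add: borel_prod)
  let ?R = "{0<..<T} \<times> {0<..<2*pi}"
  have "set_integrable lborel ?R (\<lambda>p. (cmod (\<phi> (snd p) * g (fst p)))\<^sup>2)"
    unfolding set_integrable_def
  proof (rule integrableI_bounded_set_indicator)
    show "?R \<in> sets lborel" by (simp add: open_Times borel_open)
    show "(\<lambda>p. (cmod (\<phi> (snd p) * g (fst p)))\<^sup>2) \<in> borel_measurable lborel" by measurable
    show "emeasure lborel ?R < \<infinity>"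
      by (rule emeasure_bounded_finite) (auto intro!: bounded_Times)
    show "AE p in lborel. p \<in> ?R \<longrightarrow> norm ((cmod (\<phi> (snd p) * g (fst p)))\<^sup>2) \<le> (A * G)\<^sup>2"
    proof (intro always_eventually allI impI)
      fix p assume "p \<in> ?R"
      then have "cmod (\<phi> (snd p)) \<le> A" by (intro \<phi>) auto
      then have "cmod (\<phi> (snd p)) * cmod (g (fst p)) \<le> A * G"
        using norm_ge_zero order_trans by (intro mult_mono g) blast+
      then show "norm ((cmod (\<phi> (snd p) * g (fst p)))\<^sup>2) \<le> (A * G)\<^sup>2"
        by (simp add: norm_mult power_mono)
    qed
  qed
  with m show ?thesis by (simp add: L2_rect_def)
qed

section \<open>Construction of the control\<close>

lemma wt_square_bounds: "1 + (real_of_int k)\<^sup>2 \<le> (wt k)\<^sup>2" "(wt k)\<^sup>2 \<le> 2 * (1 + (real_of_int k)\<^sup>2)"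
proof -
  have "(wt k)\<^sup>2 = 1 + 2 * \<bar>real_of_int k\<bar> + (real_of_int k)\<^sup>2"
    by (simp add: wt_def power2_eq_square algebra_simps)
  moreover have "0 \<le> (1 - \<bar>real_of_int k\<bar>)\<^sup>2" by simp
  then have "2 * \<bar>real_of_int k\<bar> \<le> 1 + (real_of_int k)\<^sup>2" by (simp add: power2_eq_square algebra_simps)
  ultimately show "1 + (real_of_int k)\<^sup>2 \<le> (wt k)\<^sup>2" "(wt k)\<^sup>2 \<le> 2 * (1 + (real_of_int k)\<^sup>2)" by auto
qed

lemma summable_inverse_one_plus_square: "(\<lambda>k. 1 / (1 + (real_of_int k)\<^sup>2)) summable_on UNIV"
proof (rule summable_on_comparison_test[OF summable_on_cmult_right[OF summable_wt, of 2]])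
  fix k
  have w: "1 \<le> sqrt (wt k)" "0 < wt k" using wt_ge_1[of k] wt_pos[of k] by auto
  have "sqrt (wt k) ^ 3 \<le> sqrt (wt k) ^ 4" using w by (intro power_increasing) auto
  also have "\<dots> = (wt k)\<^sup>2" using w power_mult[of "sqrt (wt k)" 2 2] by simp
  also have "\<dots> \<le> 2 * (1 + (real_of_int k)\<^sup>2)" by (rule wt_square_bounds)
  finally have "1 / (1 + (real_of_int k)\<^sup>2) \<le> 1 / (sqrt (wt k) ^ 3 / 2)"
    using w by (intro divide_left_mono) (auto intro!: mult_pos_pos add_pos_nonneg)
  then show "1 / (1 + (real_of_int k)\<^sup>2) \<le> 2 * (1 / sqrt (wt k) ^ 3)" by simp
qed auto

lemma square_sum3_le: "(x + y + z)\<^sup>2 \<le> 3 * (x\<^sup>2 + y\<^sup>2 + (z::real)\<^sup>2)"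
  using zero_le_power2[of "x - y"] zero_le_power2[of "y - z"] zero_le_power2[of "x - z"]
  by (simp add: power2_eq_square algebra_simps)

text \<open>Squaring the modewise bounds gives summable majorants. For \<open>v\<close>, the factor
  \<open>4 / wt k\<close> supplies the weight that makes \<open>u0\<close> summable in the dual of
  H^1; the constant \<open>B\<close> is summable against \<open>1 / (1 + k^2)\<close>.\<close>

lemma trajectory_cont_dual:
  assumes u0: "dual_space 2 u0" and v0: "dual_space 1 v0" and B: "0 \<le> B"
    and cu: "\<And>k. continuous_on {0..T} (\<lambda>t. u t k)" and cv: "\<And>k. continuous_on {0..T} (\<lambda>t. v t k)"
    and bu: "\<And>t k. t \<in> {0..T} \<Longrightarrow> cmod (u t k) \<le> 3 * cmod (u0 k) + 4 * cmod (v0 k) + 3 * B"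
    and bv: "\<And>t k. t \<in> {0..T} \<Longrightarrow> cmod (v t k) \<le> 4 / wt k * cmod (u0 k) + 3 * cmod (v0 k) + 2 * B"
  shows "cont_dual 2 T u" "cont_dual 1 T v"
proof -
  define W where "W = (\<lambda>k. 1 + (real_of_int k)\<^sup>2)"
  have Wk: "1 + (real_of_int k)\<^sup>2 = W k" for k by (simp add: W_def)
  have W1: "1 \<le> W k" for k by (simp add: W_def)
  have W0: "0 < W k" for k using W1[of k] by linarith
  have Wp: "W k powr 2 = (W k)\<^sup>2" "W k powr 1 = W k" for k using W0[of k] by simp_all
  have WW: "W k \<le> (W k)\<^sup>2" for k using W1[of k] by (simp add: self_le_power)
  define p q r where "p = (\<lambda>k. (cmod (u0 k))\<^sup>2 / (W k)\<^sup>2)" and "q = (\<lambda>k. (cmod (v0 k))\<^sup>2 / W k)" and "r = (\<lambda>k. 1 / W k)"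
  have s: "p summable_on UNIV" "q summable_on UNIV" "r summable_on UNIV"
    using u0 v0 summable_inverse_one_plus_square
    by (simp_all add: dual_space_def p_def q_def r_def W_def)
  show "cont_dual 2 T u"
  proof (rule cont_dual_dominated[OF _ _ cu])
    show "(\<lambda>k. 27 * p k + 48 * q k + 27 * B\<^sup>2 * r k) summable_on UNIV"
      by (intro summable_on_add summable_on_cmult_right s)
    fix t :: real and k assume t: "t \<in> {0..T}"
    have "(cmod (u t k))\<^sup>2 \<le> (3 * cmod (u0 k) + 4 * cmod (v0 k) + 3 * B)\<^sup>2"
      by (intro power_mono bu t) simp
    also have "\<dots> \<le> 3 * ((3 * cmod (u0 k))\<^sup>2 + (4 * cmod (v0 k))\<^sup>2 + (3 * B)\<^sup>2)" by (rule square_sum3_le)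
    finally have "(cmod (u t k))\<^sup>2 / (W k)\<^sup>2 \<le> (27 * (cmod (u0 k))\<^sup>2 + 48 * (cmod (v0 k))\<^sup>2 + 27 * B\<^sup>2) / (W k)\<^sup>2"
      by (intro divide_right_mono) (auto simp: power_mult_distrib)
    also have "\<dots> = 27 * p k + 48 * (cmod (v0 k))\<^sup>2 / (W k)\<^sup>2 + 27 * B\<^sup>2 / (W k)\<^sup>2"
      by (simp add: p_def add_divide_distrib)
    also have "\<dots> \<le> 27 * p k + 48 * (cmod (v0 k))\<^sup>2 / W k + 27 * B\<^sup>2 / W k"
      using WW[of k] W0[of k] by (intro add_mono order_refl divide_left_mono) auto
    finally show "(cmod (u t k))\<^sup>2 / (1 + (real_of_int k)\<^sup>2) powr 2 \<le> 27 * p k + 48 * q k + 27 * B\<^sup>2 * r k"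
      unfolding Wk Wp q_def r_def by simp
  qed
  show "cont_dual 1 T v"
  proof (rule cont_dual_dominated[OF _ _ cv])
    show "(\<lambda>k. 48 * p k + 27 * q k + 12 * B\<^sup>2 * r k) summable_on UNIV"
      by (intro summable_on_add summable_on_cmult_right s)
    fix t :: real and k assume t: "t \<in> {0..T}"
    have "(cmod (v t k))\<^sup>2 \<le> (4 / wt k * cmod (u0 k) + 3 * cmod (v0 k) + 2 * B)\<^sup>2"
      by (intro power_mono bv t) simp
    also have "\<dots> \<le> 3 * ((4 / wt k * cmod (u0 k))\<^sup>2 + (3 * cmod (v0 k))\<^sup>2 + (2 * B)\<^sup>2)" by (rule square_sum3_le)
    finally have "(cmod (v t k))\<^sup>2 / W k \<le> (48 * ((cmod (u0 k))\<^sup>2 / (wt k)\<^sup>2) + 27 * (cmod (v0 k))\<^sup>2 + 12 * B\<^sup>2) / W k"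
      using W0[of k] by (intro divide_right_mono) (auto simp: power_mult_distrib power_divide)
    also have "\<dots> = 48 * ((cmod (u0 k))\<^sup>2 / (wt k)\<^sup>2) / W k + 27 * q k + 12 * B\<^sup>2 * r k"
      by (simp add: q_def r_def add_divide_distrib)
    also have "48 * ((cmod (u0 k))\<^sup>2 / (wt k)\<^sup>2) / W k \<le> 48 * ((cmod (u0 k))\<^sup>2 / W k) / W k"
      using W0[of k] wt_pos[of k] wt_square_bounds(1)[of k]
      by (intro divide_right_mono mult_left_mono divide_left_mono) (auto simp: W_def)
    also have "\<dots> = 48 * p k" by (simp add: p_def power2_eq_square)
    finally show "(cmod (v t k))\<^sup>2 / (1 + (real_of_int k)\<^sup>2) powr 1 \<le> 48 * p k + 27 * q k + 12 * B\<^sup>2 * r k"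
      unfolding Wk Wp by simp
  qed
qed

text \<open>Only polynomial growth matters. The 6 counts five powers of \<open>|k|\<close> in
  \<open>ua\<close> and \<open>vb\<close>, and the offset.\<close>

lemma norm_eigval_minus_ua:
  assumes e: "is_offset e" and k: "k \<noteq> 0"
  shows "cmod (eigval e (k, b) - ua k) \<le> 6 * wt k ^ 4"
proof -
  define x where "x = \<bar>real_of_int k\<bar>"
  have w: "wt k = 1 + x" and x: "0 \<le> x" by (simp_all add: wt_def x_def)
  have "cmod (e k) \<le> 2/5" using e unfolding is_offset_def by blast
  then have ek: "cmod (e k) \<le> 1" by linarith
  have pw: "x ^ j \<le> wt k ^ 4" if "j \<le> 4" for j
  proof -
    have "x ^ j \<le> wt k ^ j" using x w by (intro power_mono) auto
    also have "\<dots> \<le> wt k ^ 4" using that wt_ge_1 by (intro power_increasing)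
    finally show ?thesis .
  qed
  have w1: "1 \<le> wt k ^ 4" using pw[of 0] by simp
  show ?thesis
  proof (cases b)
    case True
    then show ?thesis using ek w1 by simp
  next
    case False
    then have eq: "eigval e (k, b) - ua k = vb k - e k - ua k" using k by simp
    have "cmod (ua k) \<le> x ^ 4 + x ^ 3 + x ^ 2"
      unfolding ua_def x_def using norm_triangle_ineq4[of "of_int k ^ 4 + \<i> * of_int k ^ 3" "of_int k ^ 2"]
        norm_triangle_ineq[of "of_int k ^ 4" "\<i> * of_int k ^ 3"]
      by (simp add: norm_mult norm_power)
    moreover have "cmod (vb k) \<le> x ^ 2 + x ^ 1"
      unfolding vb_def x_def using norm_triangle_ineq4[of "of_int k ^ 2" "\<i> * of_int k"]
      by (simp add: norm_mult norm_power)
    ultimately show ?thesis unfolding eq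
      using norm_triangle_ineq4[of "vb k - e k" "ua k"] norm_triangle_ineq4[of "vb k" "e k"] ek w1
        pw[of 4] pw[of 3] pw[of 2] pw[of 1] by linarith
  qed
qed

text \<open>The moment for which the control cancels the initial value along the left eigenvector of
  \<open>eigval e (k, b)\<close>, as required in \<open>mode_final_zero\<close>. At
  \<open>k = 0\<close> the equation reduces to \<open>u' = F g\<close>, whence the separate
  value.\<close>

definition mode_target :: "(int \<Rightarrow> complex) \<Rightarrow> (int \<Rightarrow> complex) \<Rightarrow> (int \<Rightarrow> complex) \<Rightarrow> (int \<Rightarrow> complex) \<Rightarrow> int \<times> bool \<Rightarrow> complex" where
  "mode_target e F u0 v0 p = (case p of (k, b) \<Rightarrow>
     if k = 0 then - u0 0 / F 0
     else - (\<i> * of_int k * u0 k + (eigval e (k, b) - ua k) * v0 k) / (\<i> * of_int k * F k))"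

text \<open>The exponent 6 adds 4 for the eigenvector entry, 1 for \<open>v0\<close> and 1 for the
  lower bound on \<open>F\<close>; the contribution of \<open>u0\<close> is smaller.\<close>

lemma mode_target_bound:
  assumes e: "is_offset e" and u0: "dual_space 2 u0" and v0: "dual_space 1 v0"
    and c: "0 < c" and F: "\<And>k. c / wt k \<le> cmod (F k)"
  shows "\<exists>C. \<forall>p. cmod (mode_target e F u0 v0 p) \<le> C * wt (fst p) ^ 6"
proof -
  define A where "A = dual_norm 2 u0"
  define A' where "A' = dual_norm 1 v0"
  have A0: "0 \<le> A" "0 \<le> A'" by (simp_all add: A_def A'_def dual_norm_def infsum_nonneg)
  have u: "cmod (u0 k) \<le> A * wt k ^ 2" for k
  proof -
    have "cmod (u0 k) \<le> A * (1 + (real_of_int k)\<^sup>2) powr (2 / 2)" unfolding A_def by (rule dual_norm_coeff[OF u0])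
    also have "\<dots> = A * (1 + (real_of_int k)\<^sup>2)" by (simp add: add_pos_nonneg)
    also have "\<dots> \<le> A * wt k ^ 2" by (intro mult_left_mono wt_square_bounds A0)
    finally show ?thesis .
  qed
  have v: "cmod (v0 k) \<le> A' * wt k" for k
  proof -
    have "cmod (v0 k) \<le> A' * (1 + (real_of_int k)\<^sup>2) powr (1 / 2)" unfolding A'_def by (rule dual_norm_coeff[OF v0])
    also have "\<dots> = A' * sqrt (1 + (real_of_int k)\<^sup>2)" by (simp add: powr_half_sqrt)
    also have "\<dots> \<le> A' * wt k" using wt_square_bounds(1)[of k] wt_pos[of k] by (intro mult_left_mono A0 real_le_lsqrt) auto
    finally show ?thesis .
  qed
  have Fpos: "0 < c / wt k" for k using c wt_pos by simp
  have "cmod (mode_target e F u0 v0 (k, b)) \<le> ((A + 6 * A') / c) * wt k ^ 6" for k b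
  proof -
    have w1: "1 \<le> wt k" by (rule wt_ge_1)
    have num: "cmod (mode_target e F u0 v0 (k, b)) \<le> (cmod (u0 k) + 6 * wt k ^ 4 * cmod (v0 k)) / cmod (F k)"
    proof (cases "k = 0")
      case True
      then show ?thesis using wt_pos[of 0] by (auto simp: mode_target_def norm_divide intro!: divide_right_mono mult_nonneg_nonneg)
    next
      case False
      then have "1 \<le> \<bar>k\<bar>" by linarith
      then have n: "1 \<le> \<bar>real_of_int k\<bar>" by (simp flip: of_int_abs)
      have "cmod (\<i> * of_int k * u0 k + (eigval e (k, b) - ua k) * v0 k)
         \<le> \<bar>real_of_int k\<bar> * cmod (u0 k) + cmod (eigval e (k, b) - ua k) * cmod (v0 k)"
        using norm_triangle_ineq[of "\<i> * of_int k * u0 k" "(eigval e (k, b) - ua k) * v0 k"] by (simp add: norm_mult)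
      also have "\<dots> \<le> \<bar>real_of_int k\<bar> * cmod (u0 k) + 1 * (6 * wt k ^ 4 * cmod (v0 k))"
        using mult_right_mono[OF norm_eigval_minus_ua[OF e False, of b], of "cmod (v0 k)"] by simp
      also have "\<dots> \<le> \<bar>real_of_int k\<bar> * cmod (u0 k) + \<bar>real_of_int k\<bar> * (6 * wt k ^ 4 * cmod (v0 k))"
        using n wt_pos[of k] by (intro add_left_mono mult_right_mono) auto
      also have "\<dots> = \<bar>real_of_int k\<bar> * (cmod (u0 k) + 6 * wt k ^ 4 * cmod (v0 k))" by (simp add: distrib_left)
      finally have "cmod (\<i> * of_int k * u0 k + (eigval e (k, b) - ua k) * v0 k) / (\<bar>real_of_int k\<bar> * cmod (F k))
          \<le> \<bar>real_of_int k\<bar> * (cmod (u0 k) + 6 * wt k ^ 4 * cmod (v0 k)) / (\<bar>real_of_int k\<bar> * cmod (F k))"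
        by (rule divide_right_mono) simp
      also have "\<dots> = (cmod (u0 k) + 6 * wt k ^ 4 * cmod (v0 k)) / cmod (F k)" using False by simp
      moreover have "cmod (mode_target e F u0 v0 (k, b))
          = cmod (\<i> * of_int k * u0 k + (eigval e (k, b) - ua k) * v0 k) / (\<bar>real_of_int k\<bar> * cmod (F k))"
        using False by (simp add: mode_target_def norm_divide norm_mult del: minus_add_distrib)
      ultimately show ?thesis by simp
    qed
    have "wt k ^ 2 \<le> wt k ^ 5" using w1 by (intro power_increasing) auto
    then have "A * wt k ^ 2 \<le> A * wt k ^ 5" using A0 by (intro mult_left_mono)
    moreover have "6 * wt k ^ 4 * cmod (v0 k) \<le> 6 * wt k ^ 4 * (A' * wt k)"
      using v[of k] wt_pos[of k] by (intro mult_left_mono) auto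
    moreover have "6 * wt k ^ 4 * (A' * wt k) = 6 * A' * wt k ^ 5" by (simp add: eval_nat_numeral)
    ultimately have "cmod (u0 k) + 6 * wt k ^ 4 * cmod (v0 k) \<le> (A + 6 * A') * wt k ^ 5"
      using u[of k] by (simp add: distrib_right)
    then have "(cmod (u0 k) + 6 * wt k ^ 4 * cmod (v0 k)) / cmod (F k) \<le> ((A + 6 * A') * wt k ^ 5) / (c / wt k)"
      using F[of k] Fpos[of k] A0 wt_pos[of k] by (intro frac_le) auto
    also have "\<dots> = ((A + 6 * A') / c) * wt k ^ 6" by (simp add: eval_nat_numeral)
    finally show ?thesis using num by linarith
  qed
  then show ?thesis by (intro exI[of _ "(A + 6 * A') / c"]) auto
qed

text \<open>The factor \<open>4 / wt k\<close> replaces \<open>2 / |k|\<close>, which it dominates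
  for \<open>k \<noteq> 0\<close>, in order to include mode 0.\<close>

definition mode_trajectory ::
  "real \<Rightarrow> (real \<Rightarrow> complex) \<Rightarrow> int \<Rightarrow> complex \<Rightarrow> complex \<Rightarrow> complex \<Rightarrow> real \<Rightarrow> (real \<Rightarrow> complex) \<Rightarrow> (real \<Rightarrow> complex) \<Rightarrow> bool" where
  "mode_trajectory T g k F u0 v0 B u v \<longleftrightarrow> continuous_on {0..T} u \<and> continuous_on {0..T} v \<and>
    (\<forall>t\<in>{0..T}. u t = u0 + (LINT s:{0..t}|lborel. - ua k * u s - \<i> * of_int k * v s + F * g s) \<and>
       v t = v0 + (LINT s:{0..t}|lborel. - vb k * v s - \<i> * of_int k * u s) \<and>
       cmod (u t) \<le> 3 * cmod u0 + 4 * cmod v0 + 3 * B \<and>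
       cmod (v t) \<le> 4 / wt k * cmod u0 + 3 * cmod v0 + 2 * B)"

text \<open>Mode 0 is degenerate: all matrix entries vanish, \<open>u\<close> is a primitive of the
  control and \<open>v\<close> is constant. Every other mode is diagonalised.\<close>

lemma mode_solution:
  assumes e: "is_offset e" and T: "0 < T" and g: "continuous_on {0..T} g" and G: "\<And>s. cmod (g s) \<le> G"
    and F: "cmod F \<le> A"
  shows "\<exists>u v. mode_trajectory T g k F u0 v0 (A * (T * G)) u v"
proof -
  have G0: "0 \<le> T * G" using G[of 0] T norm_ge_zero order_trans[of 0 "cmod (g 0)" G] by simp
  have FA: "cmod F * (T * G) \<le> A * (T * G)" using F G0 by (rule mult_right_mono)
  have FA0: "0 \<le> cmod F * (T * G)" using G0 by simp
  show ?thesis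
  proof (cases "k = 0")
    case True
    let ?u = "duhamel 0 u0 F g"
    have d: "(?u has_vector_derivative F * g t) (at t within {0..T})" if "t \<in> {0..T}" for t
      using duhamel_derivative[OF g that, of 0] by simp
    have u: "?u t = u0 + (LINT s:{0..t}|lborel. F * g s)" if "t \<in> {0..T}" for t
      using integral_eq_of_derivative[OF d _ that] by (simp add: continuous_on_mult_left[OF g])
    have b: "cmod (?u t) \<le> cmod u0 + cmod F * (T * G)" if "t \<in> {0..T}" for t
      by (rule duhamel_norm[OF g that G]) simp
    have "continuous_on {0..T} ?u"
      unfolding continuous_on_eq_continuous_within using d has_vector_derivative_continuous by blast
    moreover have "ua k = 0" "vb k = 0" using True by (simp_all add: ua_def vb_def)
    moreover have "cmod (?u t) \<le> 3 * cmod u0 + 4 * cmod v0 + 3 * (A * (T * G))" if "t \<in> {0..T}" for t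
      using b[OF that] FA FA0 norm_ge_zero[of u0] norm_ge_zero[of v0] by linarith
    moreover have "cmod v0 \<le> 4 / wt k * cmod u0 + 3 * cmod v0 + 2 * (A * (T * G))"
      using FA FA0 norm_ge_zero[of v0] mult_nonneg_nonneg[of "4 / wt k" "cmod u0"] wt_pos[of k] by simp
    ultimately show ?thesis using True u unfolding mode_trajectory_def
      by (intro exI[of _ ?u] exI[of _ "\<lambda>_. v0"]) (simp add: set_lebesgue_integral_def)
  next
    case False
    then have "1 \<le> \<bar>k\<bar>" by linarith
    then have n: "1 \<le> \<bar>real_of_int k\<bar>" by (simp flip: of_int_abs)
    let ?I = "\<i> * of_int k"
    have I: "cmod ?I = \<bar>real_of_int k\<bar>" "?I\<^sup>2 = - (of_int k ^ 2)" by (simp_all add: norm_mult power_mult_distrib)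
    obtain u v where uv: "continuous_on {0..T} u" "continuous_on {0..T} v"
      "\<And>t. t \<in> {0..T} \<Longrightarrow> u t = u0 + (LINT s:{0..t}|lborel. - ua k * u s - ?I * v s + F * g s)"
      "\<And>t. t \<in> {0..T} \<Longrightarrow> v t = v0 + (LINT s:{0..t}|lborel. - vb k * v s - ?I * u s)"
      "\<And>t. t \<in> {0..T} \<Longrightarrow> cmod (u t) \<le> 3 * cmod u0 + 4 * cmod v0 + 3 * (cmod F * (T * G))"
      "\<And>t. t \<in> {0..T} \<Longrightarrow> cmod (v t) \<le> 2 / cmod ?I * cmod u0 + 3 * cmod v0 + 2 * (cmod F * (T * G))"
    proof -
      have "\<exists>u v. continuous_on {0..T} u \<and> continuous_on {0..T} v \<and>
        (\<forall>t\<in>{0..T}. u t = u0 + (LINT s:{0..t}|lborel. - ua k * u s - ?I * v s + F * g s) \<and>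
         v t = v0 + (LINT s:{0..t}|lborel. - vb k * v s - ?I * u s) \<and>
         cmod (u t) \<le> 3 * cmod u0 + 4 * cmod v0 + 3 * (cmod F * (T * G)) \<and>
         cmod (v t) \<le> 2 / cmod ?I * cmod u0 + 3 * cmod v0 + 2 * (cmod F * (T * G)))"
      proof (rule mode_exists[OF g G])
        show "1 \<le> cmod ?I" using n by (simp only: I)
        show "(eigval e (k, True) - ua k) * (eigval e (k, True) - vb k) = ?I\<^sup>2"
          "(eigval e (k, False) - ua k) * (eigval e (k, False) - vb k) = ?I\<^sup>2"
          unfolding I by (rule eigval_char[OF e False])+
        show "0 \<le> Re (eigval e (k, True))" "0 \<le> Re (eigval e (k, False))" by (rule eigval_Re_nonneg(1)[OF e])+
        show "(cmod ?I)\<^sup>2 \<le> cmod (eigval e (k, True) - eigval e (k, False))"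
          unfolding I power2_abs by (rule eigval_diff[OF e False])
        have "cmod (e k) \<le> 2/5" using e unfolding is_offset_def by blast
        then show "cmod (eigval e (k, True) - ua k) \<le> 1" by simp
        show "0 \<le> T" using T by simp
      qed
      then show ?thesis using that by blast
    qed
    have "2 / cmod ?I \<le> 4 / wt k" using n unfolding I by (simp add: wt_def field_simps)
    then have "2 / cmod ?I * cmod u0 \<le> 4 / wt k * cmod u0" by (intro mult_right_mono) auto
    then have "cmod (v t) \<le> 4 / wt k * cmod u0 + 3 * cmod v0 + 2 * (A * (T * G))" if "t \<in> {0..T}" for t
      using uv(6)[OF that] FA by linarith
    moreover have "cmod (u t) \<le> 3 * cmod u0 + 4 * cmod v0 + 3 * (A * (T * G))" if "t \<in> {0..T}" for t
      using uv(5)[OF that] FA by linarith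
    ultimately show ?thesis using uv(1-4) unfolding mode_trajectory_def
      by (intro exI[of _ u] exI[of _ v]) simp
  qed
qed

theorem theorem1p1:
  fixes T :: real and \<omega> :: "real set" and u0 v0 :: "int \<Rightarrow> complex"
  assumes "T > 0" and "open \<omega>" and "\<omega> \<noteq> {}" and "\<omega> \<subseteq> {0<..<2*pi}"
    and "dual_space 2 u0" and "dual_space 1 v0"
    and "dual_pair v0 one_coef = 0"
  shows "\<exists>(f :: real \<Rightarrow> complex) (g :: real \<Rightarrow> complex).
           (let h = (\<lambda>t x. indicator \<omega> x * f x * g t) in
             L2_rect T h \<and>
             (\<exists>u v. is_solution T h u0 v0 u v) \<and>
             (\<forall>u v. is_solution T h u0 v0 u v \<longrightarrow>
                 (\<forall>k. u T k = 0) \<and> (\<forall>k. v T k = 0)))"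
proof -
  obtain x\<^sub>0 \<rho> where \<rho>: "0 < \<rho>" "{x\<^sub>0 - \<rho>..x\<^sub>0 + \<rho>} \<subseteq> \<omega>"
    using assms(2,3) open_contains_cball[of \<omega>] by (metis cball_eq_atLeastAtMost equals0I)
  define \<alpha> \<beta> where "\<alpha> = x\<^sub>0 - \<rho>" and "\<beta> = x\<^sub>0 + \<rho>"
  have sub: "{\<alpha>..\<beta>} \<subseteq> \<omega>" and lt: "\<alpha> < \<beta>" using \<rho> by (auto simp: \<alpha>_def \<beta>_def)
  then have "\<alpha> \<in> \<omega>" "\<beta> \<in> \<omega>" by auto
  then have \<alpha>\<beta>: "0 \<le> \<alpha>" "\<beta> \<le> 2 * pi" using assms(4) by fastforce+
  \<comment> \<open>The support of \<open>f\<close> lies in \<omega>, so the factor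
    \<open>indicator \<omega>\<close> changes nothing and the forcing of mode \<open>k\<close> is
    \<open>F k * g t\<close>.\<close>
  define f :: "real \<Rightarrow> complex" where "f x = indicator {\<alpha>..\<beta>} x * exp (of_real x)" for x
  have \<omega>f: "indicator \<omega> x * f x = f x" for x using sub by (auto simp: f_def indicator_def)
  define F where "F = fcoef f"
  define A where "A = exp \<beta> + exp \<alpha>"
  have Flow: "(exp \<beta> - exp \<alpha>) / (2 * pi) / wt k \<le> cmod (F k)" and Fup: "cmod (F k) \<le> A" for k
    using fcoef_exp_window_bounds[OF \<alpha>\<beta>(1) lt \<alpha>\<beta>(2), of k] by (simp_all add: F_def A_def f_def[abs_def])
  have c: "0 < (exp \<beta> - exp \<alpha>) / (2 * pi)" using lt by simp
  have F0: "F k \<noteq> 0" for k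
    using Flow[of k] divide_pos_pos[OF c wt_pos[of k]] by auto
  obtain e where e: "is_offset e" using offset_exists by blast
  obtain C where C: "\<And>p. cmod (mode_target e F u0 v0 p) \<le> C * wt (fst p) ^ 6"
    using mode_target_bound[OF e assms(5,6) c Flow] by blast
  \<comment> \<open>One time profile \<open>g\<close> serves all modes at once, since the
    eigenvalues of different modes are separated too.\<close>
  obtain g where g: "cont_supp T g" "\<And>p. moment (eigval e p) g = mode_target e F u0 v0 p"
    using spectral_moment_problem[OF e assms(1) C] by blast
  obtain G where G: "0 \<le> G" "\<And>s. cmod (g s) \<le> G" using cont_supp_bounded[OF g(1)] by blast
  have gUNIV: "continuous_on UNIV g" using g(1) by (simp add: cont_supp_def)
  then have gc: "continuous_on {0..T} g" by (rule continuous_on_subset) simp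
  define h where "h = (\<lambda>t x. indicator \<omega> x * f x * g t)"
  have h: "h = (\<lambda>t x. f x * g t)" by (simp add: h_def \<omega>f)
  have fh: "fcoef (h s) k = F k * g s" for s k by (simp add: h F_def fcoef_mult_right)
  have "L2_rect T h" unfolding h
  proof (rule L2_rect_separated)
    show "f \<in> borel_measurable borel" unfolding f_def[abs_def] by measurable
    show "g \<in> borel_measurable borel" by (rule borel_measurable_continuous_onI[OF gUNIV])
    show "cmod (f x) \<le> exp (2 * pi)" if "x \<in> {0<..<2*pi}" for x
      using that by (auto simp: f_def norm_mult indicator_def)
    show "cmod (g t) \<le> G" for t by (rule G(2))
  qed
  moreover have "\<exists>u v. is_solution T h u0 v0 u v"
  proof -
    have "\<forall>k. \<exists>u v. mode_trajectory T g k (F k) (u0 k) (v0 k) (A * (T * G)) u v"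
      by (intro allI mode_solution[OF e assms(1) gc G(2) Fup])
    from choice[OF this] obtain u where "\<forall>k. \<exists>v. mode_trajectory T g k (F k) (u0 k) (v0 k) (A * (T * G)) (u k) v" ..
    from choice[OF this] obtain v where "\<forall>k. mode_trajectory T g k (F k) (u0 k) (v0 k) (A * (T * G)) (u k) (v k)" ..
    note uv = this[unfolded mode_trajectory_def, rule_format]
    have cuv: "continuous_on {0..T} (u k)" "continuous_on {0..T} (v k)" for k using uv[of k] by blast+
    have buv: "cmod (u k t) \<le> 3 * cmod (u0 k) + 4 * cmod (v0 k) + 3 * (A * (T * G))"
      "cmod (v k t) \<le> 4 / wt k * cmod (u0 k) + 3 * cmod (v0 k) + 2 * (A * (T * G))" if "t \<in> {0..T}" for t k
      using uv[of k] that by blast+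
    have "0 \<le> A * (T * G)" using G(1) assms(1) by (simp add: A_def)
    note cd = trajectory_cont_dual[OF assms(5,6) this, of T "\<lambda>t k. u k t" "\<lambda>t k. v k t", OF cuv buv]
    have "is_solution T h u0 v0 (\<lambda>t k. u k t) (\<lambda>t k. v k t)"
      unfolding is_solution_def fh using cd uv by (simp add: ua_def vb_def)
    then show ?thesis by blast
  qed
  \<comment> \<open>An arbitrary solution is treated, not only the one just built: the prescribed
    moments depend on the data and the control alone.\<close>
  moreover have "u T k = 0 \<and> v T k = 0" if sol: "is_solution T h u0 v0 u v" for u v k
  proof -
    have cu: "continuous_on {0..T} (\<lambda>t. u t k)" and cv: "continuous_on {0..T} (\<lambda>t. v t k)"
      using sol by (auto simp: is_solution_def intro: cont_dual_imp_continuous_on)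
    have equ: "u t k = u0 k + (LINT s:{0..t}|lborel. - ua k * u s k - \<i> * of_int k * v s k + F k * g s)"
      and eqv: "v t k = v0 k + (LINT s:{0..t}|lborel. - vb k * v s k - \<i> * of_int k * u s k)" if "t \<in> {0..T}" for t
      using sol that unfolding is_solution_def fh ua_def vb_def by blast+
    have T: "0 \<le> T" "T \<in> {0..T}" using assms(1) by auto
    show ?thesis
    proof (cases "k = 0")
      case True
      have z: "ua 0 = 0" "vb 0 = 0" by (simp_all add: ua_def vb_def)
      have "eigval e (0, True) = 0" using e z by (simp add: is_offset_def)
      then have "(LINT s:{0..T}|lborel. g s) = - u0 0 / F 0"
        using g(2)[of "(0, True)"] moment_eq_set_integral[OF g(1), of 0] by (simp add: mode_target_def)
      then have "u T k = 0" using equ[OF T(2)] True z F0[of 0] by simp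
      \<comment> \<open>The zeroth coefficient of \<open>v\<close> is conserved and cannot be
        controlled; pairing with 1 reads it off, so the zero-mean assumption makes it
        vanish.\<close>
      moreover have "v0 0 = 0"
      proof -
        have "(\<Sum>\<^sub>\<infinity>k. v0 k * cnj (one_coef k)) = (\<Sum>\<^sub>\<infinity>k\<in>{0}. v0 k * cnj (one_coef k))"
          by (rule infsum_cong_neutral) (auto simp: one_coef_def)
        then show ?thesis using assms(7) by (simp add: dual_pair_def one_coef_def)
      qed
      then have "v T k = 0" using eqv[OF T(2)] True z by (simp add: set_lebesgue_integral_def)
      ultimately show ?thesis by blast
    next
      case False
      let ?I = "\<i> * of_int k"
      have I: "?I \<noteq> 0" "?I\<^sup>2 = - (of_int k ^ 2)" using False by (simp_all add: power_mult_distrib)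
      have w: "?I * u T k + (eigval e (k, b) - ua k) * v T k = 0" for b
      proof (rule mode_final_zero[OF T(1) gc cu cv equ eqv])
        show "(eigval e (k, b) - ua k) * (eigval e (k, b) - vb k) = ?I\<^sup>2"
          unfolding I by (rule eigval_char[OF e False])
        show "?I * F k * (LINT s:{0..T}|lborel. exp (eigval e (k, b) * of_real s) * g s)
            = - (?I * u0 k + (eigval e (k, b) - ua k) * v0 k)"
          using I(1) F0[of k] False
          unfolding moment_eq_set_integral[OF g(1), symmetric] g(2) mode_target_def
          by (simp del: minus_add_distrib eigval_simps)
      qed
      \<comment> \<open>The two eigenvector relations are independent; their difference eliminates
        \<open>u T k\<close>, and then either of them gives \<open>u T k = 0\<close>.\<close>
      have "(eigval e (k, True) - eigval e (k, False)) * v T k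
          = (?I * u T k + (eigval e (k, True) - ua k) * v T k) - (?I * u T k + (eigval e (k, False) - ua k) * v T k)"
        by (simp add: algebra_simps del: eigval_simps)
      also have "\<dots> = 0" by (simp only: w diff_self)
      finally have "(eigval e (k, True) - eigval e (k, False)) * v T k = 0" .
      moreover have "eigval e (k, True) - eigval e (k, False) \<noteq> 0"
        using eigval_diff[OF e False] False by (metis norm_zero of_int_eq_0_iff power2_less_eq_zero_iff)
      ultimately have "v T k = 0" by (metis mult_eq_0_iff)
      moreover from this have "u T k = 0" using w[of True] I(1) False by simp
      ultimately show ?thesis by blast
    qed
  qed
  ultimately show ?thesis unfolding h_def[symmetric] Let_def
    by (intro exI[of _ f] exI[of _ g]) (simp add: h_def)
qed

end
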